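(* Let $f(z)=\sum_{\alpha\in A}a_\alpha z^\alpha$ be a complex Laurent polynomial in $n$ variables, where $A\subset\mathbb{Z}^n$ is a finite set and $a_\alpha\in\mathbb{C}\setminus\{0\}$ for all $\alpha\in A$. Suppose that the Newton polytope $\Delta_f$ has full dimension $n$, and write $$\Delta_f=\bigcap_{k=1}^N\{\sigma\in\mathbb{R}^n\,;\ \langle\mu_k,\sigma\rangle\geq\nu_k\},$$ where $\mu_1,\ldots,\mu_N\in\mathbb{Z}^n$ are the primitive integer inward normal vectors of the facets of $\Delta_f$ and $\nu_k\in\mathbb{Z}$. If $f$ is completely non-vanishing on the positive orthant $\mathbb{R}^n_+=(0,\infty)^n$, then the Mellin transform $M_{1/f}$ admits a meromorphic continuation (to all of $\mathbb{C}^n$) of the form $$M_{1/f}(s)=\Phi(s)\prod_{k=1}^N\Gamma(\langle\mu_k,s\rangle-\nu_k),$$ where $\Phi$ is an entire function on $\mathbb{C}^n$ and $\Gamma$ denotes Euler's gamma function.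
   Context: Notation: $z^\alpha=z_1^{\alpha_1}\cdots z_n^{\alpha_n}$, and $\langle\mu,s\rangle=\sum_j\mu_js_j$. The Newton polytope $\Delta_f$ is the convex hull of $A$ in $\mathbb{R}^n$. There is one pair $(\mu_k,\nu_k)$ for each facet of $\Delta_f$. The Mellin transform of $1/f$ is $$M_{1/f}(s)=\int_{\mathbb{R}_+^n}\frac{z^{s}}{f(z)}\,\frac{dz_1\cdots dz_n}{z_1\cdots z_n}=\int_{\mathbb{R}^n}\frac{e^{\langle s,x\rangle}}{f(e^x)}\,dx_1\cdots dx_n ,$$ where $e^x=(e^{x_1},\ldots,e^{x_n})$; under the hypothesis of complete non-vanishing on $\mathbb{R}^n_+$ it converges and is analytic for $s\in\mathbb{C}^n$ with $\operatorname{Re}s\in\operatorname{int}\Delta_f$, and it is this function that is being continued. For a face $G$ of $\Delta_f$ (of any dimension from $0$ to $\dim\Delta_f$, so vertices and $\Delta_f$ itself are included), the truncated polynomial is $f_G(z)=\sum_{\alpha\in A\cap G}a_\alpha z^\alpha$. The polynomial $f$ is said to be completely non-vanishing on a set $X$ if for all faces $G$ of $\Delta_f$ the truncated polynomial $f_G$ has no zeros on $X$ (in particular $f$ itself has no zeros on $X$). *)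

theory Defs
  imports "HOL-Analysis.Analysis"
begin

text \<open>
  Exponents are integer vectors, and a Laurent polynomial is given by its finite support
  \<open>A\<close> together with a coefficient function \<open>a\<close>, of which only the values on \<open>A\<close> matter.
\<close>

definition real_vec :: "int ^ 'n \<Rightarrow> real ^ 'n" where
  "real_vec \<alpha> = (\<chi> j. real_of_int (\<alpha> $ j))"

definition complex_vec :: "real ^ 'n \<Rightarrow> complex ^ 'n" where
  "complex_vec x = (\<chi> j. complex_of_real (x $ j))"

definition Re_vec :: "complex ^ 'n \<Rightarrow> real ^ 'n" where
  "Re_vec s = (\<chi> j. Re (s $ j))"

text \<open>The bilinear pairing, used both with real and with complex second argument.\<close>

definition pairing :: "int ^ 'n \<Rightarrow> 'a::comm_ring_1 ^ 'n \<Rightarrow> 'a" where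
  "pairing \<mu> s = (\<Sum>j\<in>UNIV. of_int (\<mu> $ j) * s $ j)"

definition laurent :: "(int ^ 'n \<Rightarrow> complex) \<Rightarrow> (int ^ 'n) set \<Rightarrow> complex ^ 'n \<Rightarrow> complex" where
  "laurent a A z = (\<Sum>\<alpha>\<in>A. a \<alpha> * (\<Prod>j\<in>UNIV. (z $ j) powi (\<alpha> $ j)))"

definition newton_polytope :: "(int ^ 'n) set \<Rightarrow> (real ^ 'n) set" where
  "newton_polytope A = convex hull (real_vec ` A)"

definition pos_orthant :: "(real ^ 'n) set" where
  "pos_orthant = {x. \<forall>j. 0 < x $ j}"

text \<open>
  The library's \<^const>\<open>face_of\<close> counts the empty set as a face; it is excluded here.
  The polytope itself is one of its faces.
\<close>

definition completely_nonvanishing ::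
    "(int ^ 'n \<Rightarrow> complex) \<Rightarrow> (int ^ 'n) set \<Rightarrow> (complex ^ 'n) set \<Rightarrow> bool" where
  "completely_nonvanishing a A X \<longleftrightarrow>
     (\<forall>G. G face_of newton_polytope A \<and> G \<noteq> {} \<longrightarrow>
        (\<forall>z\<in>X. laurent a {\<alpha> \<in> A. real_vec \<alpha> \<in> G} z \<noteq> 0))"

definition primitive :: "int ^ 'n \<Rightarrow> bool" where
  "primitive \<mu> \<longleftrightarrow> Gcd (range (\<lambda>j. \<mu> $ j)) = 1"

text \<open>
  The pairs \<open>(\<mu> k, \<nu> k)\<close> with \<open>1 \<le> k \<le> N\<close> enumerate the facets of \<open>P\<close> without repetition:
  \<open>\<mu> k\<close> is the primitive integer inward normal of the \<open>k\<close>-th facet, and \<open>\<nu> k\<close> is the constant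
  value of \<^term>\<open>pairing (\<mu> k)\<close> on that facet. Inwardness is contained in the first conjunct.
\<close>

definition facet_presentation ::
    "(real ^ 'n) set \<Rightarrow> nat \<Rightarrow> (nat \<Rightarrow> int ^ 'n) \<Rightarrow> (nat \<Rightarrow> int) \<Rightarrow> bool" where
  "facet_presentation P N \<mu> \<nu> \<longleftrightarrow>
     P = (\<Inter>k\<in>{1..N}. {\<sigma>. pairing (\<mu> k) \<sigma> \<ge> of_int (\<nu> k)}) \<and>
     (\<forall>k\<in>{1..N}. primitive (\<mu> k)) \<and>
     bij_betw (\<lambda>k. {\<sigma> \<in> P. pairing (\<mu> k) \<sigma> = of_int (\<nu> k)}) {1..N} {F. F facet_of P}"

definition mellin_integrand ::
    "(complex ^ 'n \<Rightarrow> complex) \<Rightarrow> complex ^ 'n \<Rightarrow> real ^ 'n \<Rightarrow> complex" where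
  "mellin_integrand g s z =
     (\<Prod>j\<in>UNIV. complex_of_real (z $ j) powr (s $ j)) * g (complex_vec z)
       / (\<Prod>j\<in>UNIV. complex_of_real (z $ j))"

definition mellin :: "(complex ^ 'n \<Rightarrow> complex) \<Rightarrow> complex ^ 'n \<Rightarrow> complex" where
  "mellin g s = (LINT z:pos_orthant|lebesgue. mellin_integrand g s z)"

text \<open>
  Holomorphy in several variables on open sets: the (real) Frechet derivative exists at every
  point and is complex linear.
\<close>

definition holomorphic_Cn_on :: "(complex ^ 'n \<Rightarrow> complex) \<Rightarrow> (complex ^ 'n) set \<Rightarrow> bool" where
  "holomorphic_Cn_on f U \<longleftrightarrow>
     (\<forall>s\<in>U. \<exists>L. (f has_derivative L) (at s) \<and> (\<forall>c v. L (c *s v) = c * L v))"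

text \<open>
  Meromorphy on the whole space: locally a quotient of holomorphic functions whose denominator
  does not vanish identically. The values at the zeros of the denominator are unconstrained.
\<close>

definition meromorphic_Cn :: "(complex ^ 'n \<Rightarrow> complex) \<Rightarrow> bool" where
  "meromorphic_Cn F \<longleftrightarrow>
     (\<forall>p. \<exists>U g h. open U \<and> connected U \<and> p \<in> U \<and>
        holomorphic_Cn_on g U \<and> holomorphic_Cn_on h U \<and> (\<exists>s\<in>U. h s \<noteq> 0) \<and>
        (\<forall>s\<in>U. h s \<noteq> 0 \<longrightarrow> F s = g s / h s))"

end

theory Submission
  imports Defs
begin

text \<open>
  Put \<open>E x = f (e\<^sup>x)\<close>. Complete non-vanishing gives \<open>\<bar>E x\<bar> \<ge> c \<Sum>\<^sub>\<alpha> exp \<langle>\<alpha>, x\<rangle>\<close>: a sequence violating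
  every such bound would, after normalisation and passage to a subsequence, produce a zero of the
  truncation of \<open>f\<close> to some face. Hence \<open>I m s = \<integral> exp \<langle>s, x\<rangle> / E x ^ m dx\<close> converges and is
  holomorphic where \<open>Re \<langle>\<mu>\<^sub>k, s\<rangle> > m \<nu>\<^sub>k\<close> for all \<open>k\<close>. Integrating by parts in the direction \<open>\<mu>\<^sub>k\<close>
  multiplies a combination of translates of \<open>I m\<close> by the linear factor \<open>\<langle>\<mu>\<^sub>k, s\<rangle> - \<nu>\<^sub>k + l\<^sub>k\<close> and
  turns it into a combination of translates of \<open>I (m + 1)\<close>, in which the terms that would diverge
  first cancel, so the \<open>k\<close>-th bound is relaxed by one. The linear factors collected in this way are
  those in the functional equation of \<open>\<Gamma>\<close>, so multiplying by \<open>\<Prod>\<^sub>k 1 / \<Gamma> (\<langle>\<mu>\<^sub>k, s\<rangle> - \<nu>\<^sub>k + l)\<close> gives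
  functions on growing half-space intersections which agree on overlaps.
\<close>

section \<open>Logarithmic coordinates\<close>

lemma bij_betw_axis_Basis: "bij_betw (\<lambda>j. axis j (1::real)) (UNIV :: 'n::finite set) Basis"
  by (auto simp: bij_betw_def inj_on_def Basis_vec_def axis_eq_axis)

text \<open>Tonelli's theorem for a product of one-variable functions, carried over from the index
  set \<open>Basis\<close> to coordinate indices.\<close>

lemma nn_integral_lborel_vec_prod:
  fixes f :: "'n::finite \<Rightarrow> real \<Rightarrow> real"
  assumes [measurable]: "\<And>j. f j \<in> borel_measurable borel" and nn: "\<And>j t. 0 \<le> f j t"
  shows "(\<integral>\<^sup>+x. ennreal (\<Prod>j\<in>UNIV. f j (x $ j)) \<partial>(lborel :: (real ^ 'n) measure))
    = (\<Prod>j\<in>UNIV. \<integral>\<^sup>+t. ennreal (f j t) \<partial>lborel)"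
proof -
  let ?ax = "\<lambda>j::'n. axis j (1::real)"
  \<comment> \<open>\<open>the_inv\<close> recovers the index from a basis vector, which turns
    \<open>f\<close> into a family indexed by \<open>Basis\<close>.\<close>
  define g where "g b t = ennreal (f (the_inv ?ax b) t)" for b :: "real ^ 'n" and t
  have inv: "the_inv ?ax (axis j 1) = j" for j
    by (rule the_inv_f_f) (auto simp: inj_on_def axis_eq_axis)
  have "(\<integral>\<^sup>+x. (\<Prod>b\<in>Basis. g b (x \<bullet> b)) \<partial>(lborel :: (real ^ 'n) measure))
      = (\<Prod>b\<in>Basis. \<integral>\<^sup>+t. g b t \<partial>lborel)"
    by (rule nn_integral_lborel_prod) (auto simp: g_def)
  moreover have "(\<Prod>b\<in>Basis. h b) = (\<Prod>j\<in>UNIV. h (?ax j))" for h :: "real ^ 'n \<Rightarrow> ennreal"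
    using prod.reindex_bij_betw[OF bij_betw_axis_Basis, of h] by simp
  ultimately show ?thesis
    by (simp add: g_def inv inner_axis prod_ennreal nn)
qed

lemma nn_integral_exp_abs:
  fixes d :: real
  assumes "d > 0"
  shows "(\<integral>\<^sup>+t. ennreal (exp (- d * \<bar>t\<bar>)) \<partial>lborel) < \<infinity>"
proof -
  let ?h = "\<lambda>t::real. ennreal (exp (- d * t)) * indicator {0..} t"
  have half: "(\<integral>\<^sup>+t. ?h t \<partial>lborel) = ennreal (0 - (- exp (- d * 0) / d))"
  proof (rule nn_integral_FTC_atLeast)
    show "((\<lambda>t. - exp (- d * t) / d) has_real_derivative exp (- d * x)) (at x)" for x
      using assms by (auto intro!: derivative_eq_intros)
    have "((\<lambda>t. exp (- d * t)) \<longlongrightarrow> 0) at_top"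
      using assms
      by (intro filterlim_compose[OF exp_at_bot] filterlim_tendsto_neg_mult_at_bot[OF tendsto_const]) (auto intro: filterlim_ident)
    from tendsto_divide[OF tendsto_minus[OF this] tendsto_const, of d]
    show "((\<lambda>t. - exp (- d * t) / d) \<longlongrightarrow> 0) at_top" using assms by simp
  qed auto
  have "(\<integral>\<^sup>+t. ennreal (exp (- d * \<bar>t\<bar>)) \<partial>lborel) \<le> (\<integral>\<^sup>+t. ?h t + ?h (- t) \<partial>lborel)"
    by (intro nn_integral_mono) (auto simp: indicator_def)
  also have "\<dots> = (\<integral>\<^sup>+t. ?h t \<partial>lborel) + (\<integral>\<^sup>+t. ?h (- t) \<partial>lborel)"
    by (intro nn_integral_add) auto
  also have "(\<integral>\<^sup>+t. ?h (- t) \<partial>lborel) = (\<integral>\<^sup>+t. ?h t \<partial>lborel)"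
    using nn_integral_real_affine[of ?h "-1" 0] by simp
  finally show ?thesis unfolding half by (auto simp: less_top[symmetric] top_unique)
qed

text \<open>Supplies the dominating functions for the integrals below. The norm is at least the mean
  of the absolute coordinates, so the function lies below a product of one-variable
  exponentials.\<close>

lemma integrable_exp_minus_norm:
  fixes e :: real
  assumes "e > 0"
  shows "integrable lborel (\<lambda>x :: real ^ 'n. exp (- e * norm x))"
proof (rule integrableI_bounded)
  define d where "d = e / CARD('n)"
  have d: "d > 0" using assms by (simp add: d_def)
  have *: "exp (- e * norm x) \<le> (\<Prod>j\<in>UNIV. exp (- d * \<bar>x $ j\<bar>))" for x :: "real ^ 'n"
  proof -
    have "(\<Sum>j\<in>UNIV. \<bar>x $ j\<bar>) \<le> (\<Sum>j\<in>(UNIV::'n set). norm x)"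
      by (intro sum_mono component_le_norm_cart)
    hence "d * (\<Sum>j\<in>UNIV. \<bar>x $ j\<bar>) \<le> d * (CARD('n) * norm x)"
      using d by (intro mult_left_mono) auto
    hence "- e * norm x \<le> (\<Sum>j\<in>UNIV. - d * \<bar>x $ j\<bar>)"
      by (simp add: d_def sum_distrib_left sum_negf)
    thus ?thesis by (simp add: exp_sum[symmetric] sum_negf)
  qed
  have "(\<integral>\<^sup>+x. norm (exp (- e * norm x)) \<partial>(lborel :: (real ^ 'n) measure))
      \<le> (\<integral>\<^sup>+x. ennreal (\<Prod>j\<in>UNIV. exp (- d * \<bar>x $ j\<bar>)) \<partial>(lborel :: (real ^ 'n) measure))"
    using * by (intro nn_integral_mono ennreal_leI) auto
  also have "\<dots> = (\<Prod>j\<in>(UNIV::'n set). \<integral>\<^sup>+t. ennreal (exp (- d * \<bar>t\<bar>)) \<partial>lborel)"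
    by (rule nn_integral_lborel_vec_prod) auto
  also have "\<dots> < \<infinity>"
    using nn_integral_exp_abs[OF d] by (simp add: power_less_top_ennreal)
  finally show "(\<integral>\<^sup>+x. norm (exp (- e * norm x)) \<partial>(lborel :: (real ^ 'n) measure)) < \<infinity>" .
qed auto

section \<open>The substitution z = e^x\<close>

definition ln_vec :: "real ^ 'n \<Rightarrow> real ^ 'n" where "ln_vec z = (\<chi> j. ln (z $ j))"

lemma borel_measurable_ln_vec [measurable]: "ln_vec \<in> borel_measurable borel"
  unfolding ln_vec_def by (rule borel_measurable_euclidean_space[THEN iffD2])
    (auto simp: Basis_vec_def inner_axis)

lemma pos_orthant_borel [measurable]: "pos_orthant \<in> sets (borel :: (real ^ 'n) measure)"
proof -
  have "Measurable.pred borel (\<lambda>x :: real ^ 'n. \<forall>j\<in>UNIV. 0 < x $ j)"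
    by (intro pred_intros_finite) auto
  thus ?thesis by (simp add: pos_orthant_def pred_def)
qed

text \<open>The measure dt / t gives the interval from e^l to e^u the mass u - l, because
  \<open>ln\<close> is an antiderivative of 1 / t.\<close>

lemma nn_integral_inverse_exp_box:
  fixes l u :: real
  assumes "l \<le> u"
  shows "(\<integral>\<^sup>+t. ennreal (indicator {t. 0 < t \<and> l < ln t \<and> ln t < u} t / t) \<partial>lborel) = ennreal (u - l)"
proof -
  have "(\<integral>\<^sup>+t. ennreal (indicator {t. 0 < t \<and> l < ln t \<and> ln t < u} t / t) \<partial>lborel)
     = (\<integral>\<^sup>+t. ennreal (1 / t) * indicator {exp l .. exp u} t \<partial>lborel)"
  proof (rule nn_integral_cong_AE)
    \<comment> \<open>The interval is open, but the fundamental theorem of calculus is applied on a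
      closed one; the end points form a null set.\<close>
    have "AE t in lborel. t \<noteq> exp l" "AE t in lborel. t \<noteq> exp u"
      by (rule AE_lborel_singleton)+
    thus "AE t in lborel. ennreal (indicator {t. 0 < t \<and> l < ln t \<and> ln t < u} t / t) =
      ennreal (1 / t) * indicator {exp l .. exp u} t"
    proof eventually_elim
      case (elim t)
      have "(0 < t \<and> l < ln t \<and> ln t < u) \<longleftrightarrow> t \<in> {exp l .. exp u}"
        using elim by (smt (verit) atLeastAtMost_iff exp_gt_zero exp_less_mono exp_ln ln_exp ln_less_cancel_iff)
      thus ?case by (auto simp: indicator_def)
    qed
  qed
  also have "\<dots> = ennreal (ln (exp u) - ln (exp l))"
    by (rule nn_integral_FTC_Icc)
      (use assms in \<open>auto intro!: derivative_eq_intros intro: less_le_trans[OF exp_gt_zero] order_trans[OF exp_ge_zero]\<close>)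
  finally show ?thesis by simp
qed

text \<open>Density of the multiplicative Haar measure dz_1 ... dz_n / (z_1 ... z_n) of the positive
  orthant.\<close>

abbreviation log_density :: "real ^ 'n \<Rightarrow> real" where
  "log_density z \<equiv> indicator pos_orthant z / (\<Prod>j\<in>UNIV. z $ j)"

lemma log_density_nonneg: "0 \<le> log_density z"
  by (auto simp: indicator_def pos_orthant_def intro!: prod_nonneg intro: less_imp_le)

text \<open>Lebesgue measure is determined by its values on boxes, and on the preimage of a box the
  integral of the density factors into one-variable integrals of dt / t. This replaces a computation
  with Jacobians.\<close>

lemma lborel_eq_distr_ln_vec:
  "(lborel :: (real ^ 'n) measure) = distr (density lborel log_density) borel ln_vec"
proof (rule lborel_eqI)
  fix l u :: "real ^ 'n"
  assume "\<And>b. b \<in> Basis \<Longrightarrow> l \<bullet> b \<le> u \<bullet> b"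
  hence le: "l $ j \<le> u $ j" for j
    using bij_betwE[OF bij_betw_axis_Basis] by (fastforce simp: inner_axis)
  define f where "f j t = indicator {t. 0 < t \<and> l $ j < ln t \<and> ln t < u $ j} t / t" for j and t :: real
  have eq: "ennreal (log_density z) * indicator (ln_vec -` box l u) z = ennreal (\<Prod>j\<in>UNIV. f j (z $ j))" for z
  proof (cases "z \<in> pos_orthant \<and> ln_vec z \<in> box l u")
    case True
    thus ?thesis by (auto simp: f_def pos_orthant_def ln_vec_def mem_box_cart prod_dividef)
  next
    case False
    then obtain j where "f j (z $ j) = 0"
      by (auto simp: f_def pos_orthant_def ln_vec_def mem_box_cart indicator_def)
    hence "(\<Prod>j\<in>UNIV. f j (z $ j)) = 0" by (intro prod_zero) auto
    moreover have "ennreal (log_density z) * indicator (ln_vec -` box l u) z = 0"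
      using False by (auto simp: indicator_def)
    ultimately show ?thesis by (metis ennreal_0)
  qed
  have [measurable]: "f j \<in> borel_measurable borel" for j unfolding f_def by measurable
  have "emeasure (distr (density lborel log_density) borel ln_vec) (box l u)
      = emeasure (density lborel log_density) (ln_vec -` box l u)"
    by (simp add: emeasure_distr)
  also have "\<dots> = (\<integral>\<^sup>+z. ennreal (log_density z) * indicator (ln_vec -` box l u) z \<partial>lborel)"
  proof (rule emeasure_density)
    have "ln_vec -` box l u \<inter> space borel \<in> sets borel" by measurable
    thus "ln_vec -` box l u \<in> sets lborel" by simp
  qed auto
  also have "\<dots> = (\<Prod>j\<in>UNIV. \<integral>\<^sup>+t. ennreal (f j t) \<partial>lborel)"
    unfolding eq by (rule nn_integral_lborel_vec_prod) (auto simp: f_def indicator_def)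
  also have "\<dots> = (\<Prod>j\<in>UNIV. ennreal (u $ j - l $ j))"
    unfolding f_def by (simp add: nn_integral_inverse_exp_box le)
  also have "\<dots> = ennreal (\<Prod>j\<in>UNIV. u $ j - l $ j)"
    by (rule prod_ennreal) (simp add: le)
  also have "(\<Prod>j\<in>UNIV. u $ j - l $ j) = (\<Prod>b\<in>Basis. (u - l) \<bullet> b)"
    using prod.reindex_bij_betw[OF bij_betw_axis_Basis, of "\<lambda>b. (u - l) \<bullet> b"]
    by (simp add: inner_axis)
  finally show "emeasure (distr (density lborel log_density) borel ln_vec) (box l u)
    = ennreal (\<Prod>b\<in>Basis. (u - l) \<bullet> b)" .
qed auto

lemma
  fixes g :: "real ^ 'n \<Rightarrow> complex"
  assumes [measurable]: "g \<in> borel_measurable borel"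
  shows integrable_ln_vec_iff:
      "integrable lborel g \<longleftrightarrow> integrable lborel (\<lambda>z. log_density z *\<^sub>R g (ln_vec z))" (is ?A)
    and integral_ln_vec:
      "integral\<^sup>L lborel g = (\<integral>z. log_density z *\<^sub>R g (ln_vec z) \<partial>lborel)" (is ?B)
proof -
  have d: "(\<lambda>z :: real ^ 'n. log_density z) \<in> borel_measurable lborel" by measurable
  have "integrable lborel g \<longleftrightarrow> integrable (density lborel log_density) (\<lambda>z. g (ln_vec z))"
    by (subst lborel_eq_distr_ln_vec, subst integrable_distr_eq) auto
  thus ?A using d by (subst (asm) integrable_density) (auto simp: log_density_nonneg)
  have "integral\<^sup>L lborel g = integral\<^sup>L (density lborel log_density) (\<lambda>z. g (ln_vec z))"
    by (subst lborel_eq_distr_ln_vec, subst integral_distr) auto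
  thus ?B using d by (subst (asm) integral_density) (auto simp: log_density_nonneg)
qed

section \<open>The lower bound on the positive orthant\<close>

definition exp_vec :: "real ^ 'n \<Rightarrow> real ^ 'n" where "exp_vec x = (\<chi> j. exp (x $ j))"

lemma exp_vec_in_pos_orthant: "exp_vec x \<in> pos_orthant"
  by (simp add: exp_vec_def pos_orthant_def)

lemma exp_ln_vec: "z \<in> pos_orthant \<Longrightarrow> exp_vec (ln_vec z) = z"
  by (simp add: exp_vec_def ln_vec_def pos_orthant_def vec_eq_iff)

text \<open>The value of the monomial z^\<alpha> at the point z = e^x.\<close>

definition exp_weight :: "int ^ 'n \<Rightarrow> real ^ 'n \<Rightarrow> real" where
  "exp_weight \<alpha> x = exp (real_vec \<alpha> \<bullet> x)"

lemma exp_weight_pos [simp]: "exp_weight \<alpha> x > 0" and exp_weight_nonneg [simp]: "exp_weight \<alpha> x \<ge> 0"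
  by (simp_all add: exp_weight_def)

lemma laurent_exp_vec:
  "laurent a A (complex_vec (exp_vec x)) = (\<Sum>\<alpha>\<in>A. a \<alpha> * complex_of_real (exp_weight \<alpha> x))"
proof -
  have "complex_of_real (exp t) powi k = complex_of_real (exp (real_of_int k * t))" for t k
    by (simp add: exp_power_int mult.commute flip: of_real_power_int)
  note this [simp]
  have "(\<Prod>j\<in>UNIV. (complex_vec (exp_vec x) $ j) powi (\<alpha> $ j)) = complex_of_real (exp_weight \<alpha> x)" for \<alpha>
    by (simp add: complex_vec_def exp_vec_def exp_weight_def real_vec_def inner_vec_def exp_sum)
  thus ?thesis by (simp add: laurent_def)
qed

text \<open>Sequential compactness of a finite power of the unit interval: one index at a time, a
  further subsequence is extracted.\<close>

lemma finite_family_convergent_subseq: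
  fixes T :: "nat \<Rightarrow> 'a \<Rightarrow> real"
  assumes "finite A" "\<And>i \<alpha>. \<alpha> \<in> A \<Longrightarrow> T i \<alpha> \<in> {0..1}"
  shows "\<exists>r t. strict_mono (r :: nat \<Rightarrow> nat) \<and> (\<forall>\<alpha>\<in>A. (\<lambda>i. T (r i) \<alpha>) \<longlonglongrightarrow> t \<alpha>)"
  using assms
proof (induction A)
  case empty
  show ?case using strict_mono_id by blast
next
  case (insert \<beta> A)
  then obtain r t where r: "strict_mono (r :: nat \<Rightarrow> nat)" "\<And>\<alpha>. \<alpha> \<in> A \<Longrightarrow> (\<lambda>i. T (r i) \<alpha>) \<longlonglongrightarrow> t \<alpha>"
    by (metis insertI2)
  have "\<forall>i. T (r i) \<beta> \<in> {0..1}" using insert.prems by blast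
  then obtain l r' where r': "strict_mono (r' :: nat \<Rightarrow> nat)" "((\<lambda>i. T (r i) \<beta>) \<circ> r') \<longlonglongrightarrow> l"
    using compact_Icc[of 0 "1::real"] unfolding compact_def by metis
  have "(\<lambda>i. T ((r \<circ> r') i) \<alpha>) \<longlonglongrightarrow> (t(\<beta> := l)) \<alpha>" if "\<alpha> \<in> insert \<beta> A" for \<alpha>
    using that r' insert.hyps LIMSEQ_subseq_LIMSEQ[OF r(2) r'(1)] by (auto simp: o_def)
  thus ?case using strict_mono_o[OF r(1) r'(1)] by blast
qed

text \<open>Ratios of monomials may tend to 0 or to positive limits along \<open>X\<close>. The
  exponents with a positive limit are those on a face, and there the limits are attained at a
  genuine point \<open>y\<close>. To see this, split \<open>X i = p i + w i\<close>, with
  \<open>p i\<close> in the span of the surviving differences to \<open>\<alpha>0\<close> and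
  \<open>w i\<close> orthogonal to it: \<open>p\<close> converges to \<open>y\<close>, and
  \<open>w i\<close> for one large \<open>i\<close> is normal to a supporting hyperplane that cuts
  out the face.\<close>

lemma laurent_exp_limit_face:
  fixes X :: "nat \<Rightarrow> real ^ 'n"
  assumes "finite A" "\<alpha>0 \<in> A"
    and lim: "\<And>\<alpha>. \<alpha> \<in> A \<Longrightarrow> (\<lambda>i. exp ((real_vec \<alpha> - real_vec \<alpha>0) \<bullet> X i)) \<longlonglongrightarrow> u \<alpha>"
    and nn: "\<And>\<alpha>. \<alpha> \<in> A \<Longrightarrow> u \<alpha> \<ge> 0"
  obtains G y where "G face_of newton_polytope A" "real_vec \<alpha>0 \<in> G"
    "{\<alpha> \<in> A. real_vec \<alpha> \<in> G} = {\<alpha> \<in> A. u \<alpha> > 0}"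
    "\<And>\<alpha>. \<alpha> \<in> A \<Longrightarrow> u \<alpha> > 0 \<Longrightarrow> u \<alpha> = exp ((real_vec \<alpha> - real_vec \<alpha>0) \<bullet> y)"
proof -
  define G0 where "G0 = {\<alpha> \<in> A. u \<alpha> > 0}"
  define d where "d \<alpha> = real_vec \<alpha> - real_vec \<alpha>0" for \<alpha> :: "int ^ 'n"
  have "(\<lambda>i. 1 :: real) \<longlonglongrightarrow> u \<alpha>0" using lim[OF \<open>\<alpha>0 \<in> A\<close>] by simp
  hence "u \<alpha>0 = 1" using LIMSEQ_unique tendsto_const by blast
  hence \<alpha>0: "\<alpha>0 \<in> G0" using assms(2) by (simp add: G0_def)
  have "\<exists>p w. p \<in> span (d ` G0) \<and> (\<forall>v\<in>span (d ` G0). orthogonal w v) \<and> X i = p + w" for i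
    using orthogonal_subspace_decomp_exists[of "d ` G0" "X i"] by metis
  then obtain p w where p: "\<And>i. p i \<in> span (d ` G0)"
    and w: "\<And>i v. v \<in> span (d ` G0) \<Longrightarrow> w i \<bullet> v = 0" and X: "\<And>i. X i = p i + w i"
    unfolding orthogonal_def by metis
  have G0lim: "(\<lambda>i. d \<alpha> \<bullet> p i) \<longlonglongrightarrow> ln (u \<alpha>)" if "\<alpha> \<in> G0" for \<alpha>
  proof -
    have "(\<lambda>i. ln (exp (d \<alpha> \<bullet> X i))) \<longlonglongrightarrow> ln (u \<alpha>)"
      using lim[of \<alpha>] that by (intro tendsto_ln) (auto simp: G0_def d_def)
    moreover have "d \<alpha> \<bullet> X i = d \<alpha> \<bullet> p i" for i
      using w[of "d \<alpha>" i] that by (simp add: X inner_add_right span_base inner_commute)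
    ultimately show ?thesis by simp
  qed
  have span_conv: "convergent (\<lambda>i. v \<bullet> p i)" if "v \<in> span (d ` G0)" for v
    using that
  proof (induction rule: span_induct_alt)
    case base
    show ?case by (simp add: convergent_const)
  next
    case (step c x y)
    then obtain \<alpha> where "\<alpha> \<in> G0" "x = d \<alpha>" by auto
    hence "convergent (\<lambda>i. c * (x \<bullet> p i))"
      using G0lim[of \<alpha>] by (intro convergent_mult convergent_const) (auto intro: convergentI)
    from convergent_add[OF this step(2)] show ?case by (simp add: inner_add_left)
  qed
  \<comment> \<open>The component of \<open>v\<close> orthogonal to the span has inner product 0
    with \<open>p i\<close>, so convergence on the span suffices. Taking \<open>v\<close> to be a
    coordinate vector then gives the limit \<open>y\<close>.\<close>
  have conv: "convergent (\<lambda>i. v \<bullet> p i)" for v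
  proof -
    obtain q z where q: "q \<in> span (d ` G0)" and z: "\<And>v. v \<in> span (d ` G0) \<Longrightarrow> orthogonal z v" and "v = q + z"
      using orthogonal_subspace_decomp_exists[of "d ` G0" v] by metis
    hence "v \<bullet> p i = q \<bullet> p i" for i using p[of i] by (auto simp: inner_add_left orthogonal_def)
    thus ?thesis using span_conv[OF q] by simp
  qed
  define y where "y = (\<chi> j. lim (\<lambda>i. p i $ j))"
  have "p \<longlonglongrightarrow> y"
  proof (rule vec_tendstoI)
    fix j
    have "convergent (\<lambda>i. p i $ j)" using conv[of "axis j 1"] by (simp add: inner_axis')
    thus "(\<lambda>i. p i $ j) \<longlonglongrightarrow> y $ j" by (simp add: y_def convergent_LIMSEQ_iff)
  qed
  hence py: "(\<lambda>i. v \<bullet> p i) \<longlonglongrightarrow> v \<bullet> y" for v by (intro tendsto_intros)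
  have uy: "u \<alpha> = exp (d \<alpha> \<bullet> y)" if "\<alpha> \<in> G0" for \<alpha>
  proof -
    have "ln (u \<alpha>) = d \<alpha> \<bullet> y" using LIMSEQ_unique[OF G0lim[OF that] py] .
    thus ?thesis using that by (metis (mono_tags, lifting) G0_def exp_ln mem_Collect_eq)
  qed
  have "\<forall>\<^sub>F i in sequentially. d \<alpha> \<bullet> w i < 0" if "\<alpha> \<in> A - G0" for \<alpha>
  proof -
    have "u \<alpha> = 0" using that nn[of \<alpha>] by (auto simp: G0_def)
    \<comment> \<open>Since \<open>p\<close> converges, the decay to 0 can only come from
      \<open>w i\<close>; cancelling the contribution of \<open>p i\<close> leaves exp of
      \<open>d \<alpha> \<bullet> w i\<close>, which is therefore eventually below 1.\<close>
    hence "(\<lambda>i. exp (d \<alpha> \<bullet> X i) * exp (- (d \<alpha> \<bullet> p i))) \<longlonglongrightarrow> 0 * exp (- (d \<alpha> \<bullet> y))"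
      using lim[of \<alpha>] that by (intro tendsto_mult tendsto_exp tendsto_minus py) (auto simp: d_def)
    hence "\<forall>\<^sub>F i in sequentially. exp (d \<alpha> \<bullet> X i) * exp (- (d \<alpha> \<bullet> p i)) < 1"
      by (intro order_tendstoD(2)[where y = 0]) auto
    thus ?thesis by eventually_elim (simp add: X inner_add_right flip: exp_add)
  qed
  hence "\<forall>\<^sub>F i in sequentially. \<forall>\<alpha>\<in>A - G0. d \<alpha> \<bullet> w i < 0"
    using assms(1) by (intro eventually_ball_finite) auto
  then obtain i where i: "\<And>\<alpha>. \<alpha> \<in> A - G0 \<Longrightarrow> d \<alpha> \<bullet> w i < 0"
    by (auto simp: eventually_sequentially)
  have i0: "d \<alpha> \<bullet> w i = 0" if "\<alpha> \<in> G0" for \<alpha>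
    using w[of "d \<alpha>" i] that by (simp add: span_base inner_commute)
  define G where "G = newton_polytope A \<inter> {x. w i \<bullet> x = w i \<bullet> real_vec \<alpha>0}"
  have "real_vec ` A \<subseteq> {x. w i \<bullet> x \<le> w i \<bullet> real_vec \<alpha>0}"
  proof clarify
    fix \<alpha> assume "\<alpha> \<in> A"
    hence "d \<alpha> \<bullet> w i \<le> 0" using i[of \<alpha>] i0[of \<alpha>] by (cases "\<alpha> \<in> G0") auto
    thus "w i \<bullet> real_vec \<alpha> \<le> w i \<bullet> real_vec \<alpha>0" by (simp add: d_def inner_diff_left inner_commute[of "w i"])
  qed
  hence sub: "newton_polytope A \<subseteq> {x. w i \<bullet> x \<le> w i \<bullet> real_vec \<alpha>0}"
    unfolding newton_polytope_def by (intro hull_minimal convex_halfspace_le)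
  have face: "G face_of newton_polytope A"
    unfolding G_def
    by (intro face_of_Int_supporting_hyperplane_le_strong convex_Int convex_hyperplane)
      (use sub in \<open>auto simp: newton_polytope_def\<close>)
  have inP: "real_vec \<alpha> \<in> newton_polytope A" if "\<alpha> \<in> A" for \<alpha>
    using that by (auto simp: newton_polytope_def intro: hull_inc)
  hence \<alpha>0G: "real_vec \<alpha>0 \<in> G" using assms(2) by (simp add: G_def)
  have AG: "{\<alpha> \<in> A. real_vec \<alpha> \<in> G} = G0"
  proof -
    have "real_vec \<alpha> \<in> G \<longleftrightarrow> \<alpha> \<in> G0" if "\<alpha> \<in> A" for \<alpha>
    proof -
      have "real_vec \<alpha> \<in> G \<longleftrightarrow> d \<alpha> \<bullet> w i = 0"
        using inP[OF that] by (auto simp: G_def d_def inner_diff_left inner_commute[of "w i"])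
      also have "\<dots> \<longleftrightarrow> \<alpha> \<in> G0"
        using i[of \<alpha>] i0[of \<alpha>] that by (cases "\<alpha> \<in> G0") auto
      finally show ?thesis .
    qed
    hence "{\<alpha> \<in> A. real_vec \<alpha> \<in> G} = {\<alpha> \<in> A. \<alpha> \<in> G0}" by (rule Collect_cong[OF conj_cong[OF refl]])
    thus ?thesis by (simp add: G0_def)
  qed
  show ?thesis
  proof (rule that[of G y])
    show "{\<alpha> \<in> A. real_vec \<alpha> \<in> G} = {\<alpha> \<in> A. u \<alpha> > 0}" using AG unfolding G0_def .
    show "u \<alpha> = exp ((real_vec \<alpha> - real_vec \<alpha>0) \<bullet> y)" if "\<alpha> \<in> A" "u \<alpha> > 0" for \<alpha>
    proof -
      have "\<alpha> \<in> G0" using that unfolding G0_def by blast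
      from uy[OF this] show ?thesis unfolding d_def .
    qed
  qed (fact face, fact \<alpha>0G)
qed

text \<open>Complete non-vanishing enters the proof through this bound. Divided by their sum
  \<open>S\<close>, the monomials lie in the unit interval, which makes compactness available
  although \<open>x\<close> ranges over an unbounded set.\<close>

lemma laurent_lower_bound:
  fixes A :: "(int ^ 'n) set"
  assumes "finite A" and ne: "A \<noteq> {}"
    and nonvan: "completely_nonvanishing a A (complex_vec ` pos_orthant)"
  obtains c where "c > 0"
    "\<And>x. c * (\<Sum>\<alpha>\<in>A. exp_weight \<alpha> x) \<le> norm (laurent a A (complex_vec (exp_vec x)))"
proof (rule ccontr)
  assume contra: "\<not> thesis"
  define S where "S x = (\<Sum>\<alpha>\<in>A. exp_weight \<alpha> x)" for x
  have S: "S x > 0" for x unfolding S_def using assms by (intro sum_pos) auto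
  have "\<exists>x. norm (laurent a A (complex_vec (exp_vec x))) < inverse (real (Suc i)) * S x" for i
    using contra that[of "inverse (real (Suc i))"] by (force simp: S_def not_le)
  then obtain X0 where X0: "\<And>i. norm (laurent a A (complex_vec (exp_vec (X0 i)))) < inverse (real (Suc i)) * S (X0 i)"
    by metis
  have T01: "exp_weight \<alpha> x / S x \<in> {0..1}" if "\<alpha> \<in> A" for \<alpha> x
    using that S[of x] member_le_sum[of \<alpha> A "\<lambda>\<alpha>. exp_weight \<alpha> x"] assms(1)
    by (auto simp: S_def divide_le_eq_1)
  obtain r t where r: "strict_mono (r :: nat \<Rightarrow> nat)"
    and t: "\<And>\<alpha>. \<alpha> \<in> A \<Longrightarrow> (\<lambda>i. exp_weight \<alpha> (X0 (r i)) / S (X0 (r i))) \<longlonglongrightarrow> t \<alpha>"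
    using finite_family_convergent_subseq[OF assms(1), of "\<lambda>i \<alpha>. exp_weight \<alpha> (X0 i) / S (X0 i)"] T01
    by blast
  define X where "X i = X0 (r i)" for i
  note t = t[folded X_def]
  have t0: "t \<alpha> \<ge> 0" if "\<alpha> \<in> A" for \<alpha>
    using T01[OF that] by (intro LIMSEQ_le_const[OF t[OF that]]) auto
  have "(\<lambda>i. \<Sum>\<alpha>\<in>A. exp_weight \<alpha> (X i) / S (X i)) \<longlonglongrightarrow> (\<Sum>\<alpha>\<in>A. t \<alpha>)"
    by (intro tendsto_sum t)
  moreover have "(\<Sum>\<alpha>\<in>A. exp_weight \<alpha> (X i) / S (X i)) = 1" for i
    using S[of "X i"] by (simp add: S_def flip: sum_divide_distrib)
  ultimately have "(\<Sum>\<alpha>\<in>A. t \<alpha>) = 1" by (simp add: LIMSEQ_const_iff)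
  \<comment> \<open>The limiting shares sum to 1, so some monomial keeps a positive share; it
    becomes the reference monomial.\<close>
  then obtain \<alpha>0 where \<alpha>0: "\<alpha>0 \<in> A" "t \<alpha>0 > 0"
    using t0 by (metis less_eq_real_def sum.neutral zero_neq_one)
  define u where "u \<alpha> = t \<alpha> / t \<alpha>0" for \<alpha>
  have lim: "(\<lambda>i. exp ((real_vec \<alpha> - real_vec \<alpha>0) \<bullet> X i)) \<longlonglongrightarrow> u \<alpha>" if "\<alpha> \<in> A" for \<alpha>
  proof -
    have "(\<lambda>i. (exp_weight \<alpha> (X i) / S (X i)) / (exp_weight \<alpha>0 (X i) / S (X i))) \<longlonglongrightarrow> u \<alpha>"
      unfolding u_def using \<alpha>0 that by (intro tendsto_divide t) auto
    moreover have "(exp_weight \<alpha> (X i) / S (X i)) / (exp_weight \<alpha>0 (X i) / S (X i)) = exp ((real_vec \<alpha> - real_vec \<alpha>0) \<bullet> X i)" for i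
      using S[of "X i"] by (simp add: exp_weight_def inner_diff_left exp_diff)
    ultimately show ?thesis by simp
  qed
  obtain G y where G: "G face_of newton_polytope A" "real_vec \<alpha>0 \<in> G"
    "{\<alpha> \<in> A. real_vec \<alpha> \<in> G} = {\<alpha> \<in> A. u \<alpha> > 0}"
    and y: "\<And>\<alpha>. \<alpha> \<in> A \<Longrightarrow> u \<alpha> > 0 \<Longrightarrow> u \<alpha> = exp ((real_vec \<alpha> - real_vec \<alpha>0) \<bullet> y)"
    using laurent_exp_limit_face[OF assms(1) \<alpha>0(1) lim] t0 \<alpha>0 by (auto simp: u_def)
  have "(\<lambda>i. norm (\<Sum>\<alpha>\<in>A. a \<alpha> * complex_of_real (exp_weight \<alpha> (X i) / S (X i)))) \<longlonglongrightarrow> 0"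
  proof (rule tendsto_sandwich[OF _ _ tendsto_const])
    show "(\<lambda>i. inverse (real (Suc (r i)))) \<longlonglongrightarrow> 0"
      using LIMSEQ_subseq_LIMSEQ[OF LIMSEQ_inverse_real_of_nat r] by (simp add: o_def)
    show "\<forall>\<^sub>F i in sequentially. norm (\<Sum>\<alpha>\<in>A. a \<alpha> * complex_of_real (exp_weight \<alpha> (X i) / S (X i))) \<le> inverse (real (Suc (r i)))"
    proof (rule always_eventually, rule allI)
      fix i
      have "(\<Sum>\<alpha>\<in>A. a \<alpha> * complex_of_real (exp_weight \<alpha> (X i) / S (X i)))
          = laurent a A (complex_vec (exp_vec (X i))) / complex_of_real (S (X i))"
        by (simp add: laurent_exp_vec sum_divide_distrib)
      thus "norm (\<Sum>\<alpha>\<in>A. a \<alpha> * complex_of_real (exp_weight \<alpha> (X i) / S (X i))) \<le> inverse (real (Suc (r i)))"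
        using X0[of "r i"] S[of "X i"] by (simp add: norm_divide X_def pos_divide_le_eq)
    qed
  qed auto
  moreover have "(\<lambda>i. norm (\<Sum>\<alpha>\<in>A. a \<alpha> * complex_of_real (exp_weight \<alpha> (X i) / S (X i))))
      \<longlonglongrightarrow> norm (\<Sum>\<alpha>\<in>A. a \<alpha> * complex_of_real (t \<alpha>))"
    by (intro tendsto_norm tendsto_sum tendsto_mult tendsto_const tendsto_of_real t)
  ultimately have "(\<Sum>\<alpha>\<in>A. a \<alpha> * complex_of_real (t \<alpha>)) = 0"
    using LIMSEQ_unique by fastforce
  also have "(\<Sum>\<alpha>\<in>A. a \<alpha> * complex_of_real (t \<alpha>)) = (\<Sum>\<alpha> | \<alpha> \<in> A \<and> u \<alpha> > 0. a \<alpha> * complex_of_real (t \<alpha>))"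
  proof (rule sum.mono_neutral_right)
    show "\<forall>\<alpha>\<in>A - {\<alpha> \<in> A. 0 < u \<alpha>}. a \<alpha> * complex_of_real (t \<alpha>) = 0"
      using t0 \<alpha>0(2) by (force simp: u_def zero_less_divide_iff)
  qed (use assms in auto)
  \<comment> \<open>On the face, every \<open>t \<alpha>\<close> is the monomial at \<open>y\<close>
    times one common positive constant, so the vanishing sum is a multiple of the truncation at
    \<open>e^y\<close>.\<close>
  also have "\<dots> = (\<Sum>\<alpha> | \<alpha> \<in> A \<and> u \<alpha> > 0. (a \<alpha> * complex_of_real (exp_weight \<alpha> y)) * complex_of_real (t \<alpha>0 / exp_weight \<alpha>0 y))"
  proof (rule sum.cong)
    fix \<alpha> assume "\<alpha> \<in> {\<alpha> \<in> A. 0 < u \<alpha>}"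
    hence "t \<alpha> = t \<alpha>0 * (exp_weight \<alpha> y / exp_weight \<alpha>0 y)"
      using y[of \<alpha>] \<alpha>0(2) by (simp add: u_def exp_weight_def inner_diff_left exp_diff field_simps)
    thus "a \<alpha> * complex_of_real (t \<alpha>) = (a \<alpha> * complex_of_real (exp_weight \<alpha> y)) * complex_of_real (t \<alpha>0 / exp_weight \<alpha>0 y)"
      by simp
  qed auto
  also have "\<dots> = laurent a {\<alpha> \<in> A. real_vec \<alpha> \<in> G} (complex_vec (exp_vec y)) * complex_of_real (t \<alpha>0 / exp_weight \<alpha>0 y)"
    by (simp only: G(3) laurent_exp_vec sum_distrib_right)
  finally have "laurent a {\<alpha> \<in> A. real_vec \<alpha> \<in> G} (complex_vec (exp_vec y)) = 0"
    using \<alpha>0(2) by (simp add: less_imp_neq[symmetric] exp_weight_def)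
  thus False
    using nonvan G(1,2) exp_vec_in_pos_orthant[of y] unfolding completely_nonvanishing_def by blast
qed

section \<open>Convergence of the integrals\<close>

text \<open>The pairing with a complex exponent and a real point, so that exp of it is z^s at z =
  e^x; \<open>pairing\<close> has an integer vector as first argument instead.\<close>

definition cpair :: "complex ^ 'n \<Rightarrow> real ^ 'n \<Rightarrow> complex" where
  "cpair s x = (\<Sum>j\<in>UNIV. s $ j * complex_of_real (x $ j))"

lemma cpair_add_left: "cpair (s + h) x = cpair s x + cpair h x"
  by (simp add: cpair_def distrib_right sum.distrib)

lemma cpair_add_right: "cpair s (x + y) = cpair s x + cpair s y"
  by (simp add: cpair_def distrib_left sum.distrib)

lemma cpair_scaleR_right: "cpair s (t *\<^sub>R x) = of_real t * cpair s x"
  by (simp add: cpair_def sum_distrib_left mult_ac)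

lemma Re_cpair: "Re (cpair s x) = Re_vec s \<bullet> x"
  by (simp add: cpair_def Re_vec_def inner_vec_def)

lemma norm_cpair_le: "norm (cpair s x) \<le> norm s * norm x"
proof -
  have "norm (cpair s x) \<le> (\<Sum>j\<in>UNIV. norm (s $ j) * \<bar>x $ j\<bar>)"
    unfolding cpair_def by (rule order_trans[OF norm_sum]) (simp add: norm_mult)
  also have "\<dots> = (\<Sum>j\<in>UNIV. \<bar>norm (s $ j)\<bar> * \<bar>x $ j\<bar>)" by simp
  also have "\<dots> \<le> L2_set (\<lambda>j. norm (s $ j)) UNIV * L2_set (\<lambda>j. x $ j) UNIV"
    by (rule L2_set_mult_ineq)
  finally show ?thesis by (simp add: norm_vec_def L2_set_def)
qed

lemma continuous_cpair [continuous_intros]: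
  "continuous_on S f \<Longrightarrow> continuous_on S (\<lambda>x. cpair s (f x))"
  unfolding cpair_def by (intro continuous_intros)

abbreviation lattice_vec :: "int ^ 'n \<Rightarrow> complex ^ 'n" where
  "lattice_vec \<alpha> \<equiv> complex_vec (real_vec \<alpha>)"

lemma lattice_vec_add: "lattice_vec (\<alpha> + \<beta>) = lattice_vec \<alpha> + lattice_vec \<beta>"
  by (simp add: complex_vec_def real_vec_def vec_eq_iff)

lemma lattice_vec_0: "lattice_vec 0 = 0"
  by (simp add: complex_vec_def real_vec_def vec_eq_iff)

lemma cpair_lattice_vec: "cpair (lattice_vec \<alpha>) x = complex_of_real (real_vec \<alpha> \<bullet> x)"
  by (simp add: cpair_def complex_vec_def inner_vec_def)

lemma cpair_real_vec: "cpair s (real_vec \<kappa>) = pairing \<kappa> s"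
  by (simp add: cpair_def pairing_def real_vec_def mult.commute)

lemma pairing_real: "pairing \<kappa> x = real_vec \<kappa> \<bullet> x"
  by (simp add: pairing_def real_vec_def inner_vec_def)

lemma Re_pairing: "Re (pairing \<kappa> s) = real_vec \<kappa> \<bullet> Re_vec s"
  by (simp flip: cpair_real_vec add: Re_cpair inner_commute)

lemma pairing_add: "pairing \<kappa> (s + t) = pairing \<kappa> s + pairing \<kappa> t"
  by (simp add: pairing_def distrib_left sum.distrib)

lemma pairing_lattice_vec: "pairing \<kappa> (lattice_vec \<alpha>) = of_int (pairing \<kappa> \<alpha>)"
  by (simp add: pairing_def complex_vec_def real_vec_def)

lemma inner_real_vec: "real_vec \<alpha> \<bullet> real_vec \<kappa> = of_int (pairing \<kappa> \<alpha>)"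
  by (simp add: pairing_def real_vec_def inner_vec_def mult.commute)

text \<open>Divided by the norm of \<open>h\<close>, a quadratic remainder still tends to 0. The
  derivative of \<open>I m\<close> can thus be verified by a single integral estimate.\<close>

lemma has_derivative_quadratic_remainder:
  fixes f :: "'a::real_normed_vector \<Rightarrow> 'b::real_normed_vector"
  assumes "bounded_linear L" "d > 0"
    and rem: "\<And>h. norm h \<le> d \<Longrightarrow> norm (f (s + h) - f s - L h) \<le> B * (norm h)\<^sup>2"
  shows "(f has_derivative L) (at s)"
  unfolding has_derivative_at
proof (rule conjI[OF assms(1)], rule Lim_null_comparison)
  have "\<forall>\<^sub>F h :: 'a in at 0. norm h < d"
    using assms(2) by (auto simp: eventually_at dist_norm)
  thus "\<forall>\<^sub>F h in at 0. norm (norm (f (s + h) - f s - L h) / norm h) \<le> B * norm h"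
  proof eventually_elim
    case (elim h)
    have "norm (f (s + h) - f s - L h) / norm h \<le> B * norm h" if "h \<noteq> 0"
      using rem[of h] elim that by (subst pos_divide_le_eq) (auto simp: power2_eq_square mult.assoc)
    thus ?case by (cases "h = 0") auto
  qed
  show "((\<lambda>h. B * norm h) \<longlongrightarrow> 0) (at 0)" by (auto intro!: tendsto_eq_intros)
qed

text \<open>Trades the quadratic factor of a Taylor remainder for a small loss in the exponential
  rate.\<close>

lemma quadratic_le_exp:
  fixes d t :: real
  assumes "d > 0" "t \<ge> 0"
  shows "t\<^sup>2 \<le> 2 / d\<^sup>2 * exp (d * t)"
proof -
  have "(d * t)\<^sup>2 / 2 \<le> exp (d * t)"
    using exp_lower_Taylor_quadratic[of "d * t"] mult_nonneg_nonneg[of d t] assms by linarith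
  thus ?thesis using assms by (simp add: field_simps)
qed

text \<open>Integration by parts with no boundary term: the difference quotients of \<open>F\<close>
  along \<open>v\<close> have integral 0 by translation invariance, and they converge to
  \<open>D\<close> under a common majorant.\<close>

lemma integral_directional_derivative_eq_0:
  fixes F D :: "real ^ 'n \<Rightarrow> complex"
  assumes F: "integrable lborel F" and D [measurable]: "D \<in> borel_measurable borel"
    and deriv: "\<And>x t. ((\<lambda>t. F (x + t *\<^sub>R v)) has_vector_derivative D (x + t *\<^sub>R v)) (at t)"
    and "e > 0" and bound: "\<And>x. norm (D x) \<le> C * exp (- e * norm x)"
  shows "integral\<^sup>L lborel D = 0"
proof -
  have [measurable]: "F \<in> borel_measurable borel" using F by auto
  have C: "C \<ge> 0" using bound[of 0] norm_ge_zero[of "D 0"] by (simp del: norm_ge_zero)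
  \<comment> \<open>The extra factor pays for evaluating \<open>D\<close> at points up to a distance
    \<open>norm v\<close> from \<open>x\<close>.\<close>
  define w where "w x = C * exp (e * norm v) * exp (- e * norm x)" for x :: "real ^ 'n"
  define u where "u i x = real (Suc i) *\<^sub>R (F (x + (1 / real (Suc i)) *\<^sub>R v) - F x)" for i x
  have "(\<lambda>i. integral\<^sup>L lborel (u i)) \<longlonglongrightarrow> integral\<^sup>L lborel D"
  proof (rule integral_dominated_convergence)
    show "integrable lborel w"
      unfolding w_def using integrable_exp_minus_norm[OF \<open>e > 0\<close>] by (intro integrable_mult_right) auto
    show "AE x in lborel. (\<lambda>i. u i x) \<longlonglongrightarrow> D x"
    proof (rule AE_I2)
      fix x
      have "((\<lambda>t. F (x + t *\<^sub>R v)) has_derivative (\<lambda>h. h *\<^sub>R D x)) (at 0)"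
        using deriv[of x 0] by (simp add: has_vector_derivative_def)
      hence "((\<lambda>h. norm (F (x + h *\<^sub>R v) - F x - h *\<^sub>R D x) / norm h) \<longlongrightarrow> 0) (at 0)"
        by (simp add: has_derivative_at)
      moreover have "filterlim (\<lambda>i. 1 / real (Suc i)) (at 0) sequentially"
        using LIMSEQ_inverse_real_of_nat by (intro filterlim_atI) (auto simp: inverse_eq_divide)
      ultimately have "(\<lambda>i. norm (F (x + (1 / real (Suc i)) *\<^sub>R v) - F x - (1 / real (Suc i)) *\<^sub>R D x) / norm (1 / real (Suc i))) \<longlonglongrightarrow> 0"
        by (rule filterlim_compose)
      moreover have "norm (F (x + (1 / real (Suc i)) *\<^sub>R v) - F x - (1 / real (Suc i)) *\<^sub>R D x) / norm (1 / real (Suc i))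
        = norm (u i x - D x)" for i
      proof -
        have "u i x - D x = real (Suc i) *\<^sub>R (F (x + (1 / real (Suc i)) *\<^sub>R v) - F x - (1 / real (Suc i)) *\<^sub>R D x)"
          by (simp add: u_def scaleR_diff_right del: of_nat_Suc)
        thus ?thesis by (simp del: of_nat_Suc)
      qed
      ultimately show "(\<lambda>i. u i x) \<longlonglongrightarrow> D x"
        by (simp add: tendsto_norm_zero_iff LIM_zero_iff)
    qed
    show "AE x in lborel. norm (u i x) \<le> w x" for i
    proof (rule AE_I2)
      fix x
      define r where "r = 1 / real (Suc i)"
      have r: "r > 0" "r \<le> 1" by (auto simp: r_def)
      \<comment> \<open>Mean value inequality in \<open>t\<close> on the unit interval, which
        contains every step length \<open>r\<close>.\<close>
      have "norm (F (x + r *\<^sub>R v) - F (x + 0 *\<^sub>R v)) \<le> w x * norm (r - 0)"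
      proof (rule differentiable_bound[where S = "{0..1}"])
        show "((\<lambda>t. F (x + t *\<^sub>R v)) has_derivative (\<lambda>h. h *\<^sub>R D (x + t *\<^sub>R v))) (at t within {0..1})" for t
          using deriv[of x t] by (simp add: has_vector_derivative_def has_derivative_at_withinI)
        fix t :: real assume t: "t \<in> {0..1}"
        have "norm x \<le> norm (x + t *\<^sub>R v) + norm (t *\<^sub>R v)" using norm_triangle_ineq4[of "x + t *\<^sub>R v" "t *\<^sub>R v"] by simp
        also have "norm (t *\<^sub>R v) \<le> norm v" using t by (simp add: mult_left_le_one_le)
        finally have "e * norm x \<le> e * norm (x + t *\<^sub>R v) + e * norm v"
          using \<open>e > 0\<close> by (simp flip: distrib_left)
        hence "C * exp (- e * norm (x + t *\<^sub>R v)) \<le> C * (exp (e * norm v) * exp (- e * norm x))"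
          using C by (intro mult_left_mono) (auto simp flip: exp_add)
        hence "norm (D (x + t *\<^sub>R v)) \<le> w x"
          using bound[of "x + t *\<^sub>R v"] by (simp add: w_def mult_ac)
        thus "onorm (\<lambda>h. h *\<^sub>R D (x + t *\<^sub>R v)) \<le> w x"
          by (intro onorm_le) (auto simp: mult.commute intro!: mult_left_mono)
      qed (use r in auto)
      hence "real (Suc i) * norm (F (x + r *\<^sub>R v) - F x) \<le> real (Suc i) * (w x * r)"
        using r by (intro mult_left_mono) auto
      thus "norm (u i x) \<le> w x" by (simp add: u_def r_def del: of_nat_Suc)
    qed
    show "u i \<in> borel_measurable lborel" for i unfolding u_def by measurable
  qed auto
  moreover have "integral\<^sup>L lborel (u i) = 0" for i
  proof -
    define y where "y = (1 / real (Suc i)) *\<^sub>R v"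
    have shift: "integral\<^sup>L lborel (\<lambda>x. F (y + x)) = integral\<^sup>L lborel F"
      using integral_distr[of "(+) y" lborel borel F] by (simp add: lborel_distr_plus)
    have "integrable (distr lborel borel ((+) y)) F" using F by (simp add: lborel_distr_plus)
    hence "integrable lborel (\<lambda>x. F (y + x))" by (simp add: integrable_distr_eq)
    hence "integral\<^sup>L lborel (\<lambda>x. F (y + x) - F x) = 0" using F shift by simp
    thus ?thesis by (simp add: u_def[abs_def] y_def add.commute del: of_nat_Suc)
  qed
  ultimately show ?thesis by (simp add: LIMSEQ_const_iff)
qed

text \<open>Complete non-vanishing is present in the form of the lower bound with constant
  \<open>c\<close>, and the facets in the form of the half-space description.\<close>

locale mellin_data =
  fixes A :: "(int ^ 'n) set" and a :: "int ^ 'n \<Rightarrow> complex"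
    and N :: nat and \<mu> :: "nat \<Rightarrow> int ^ 'n" and \<nu> :: "nat \<Rightarrow> int" and c :: real
  assumes finite_A: "finite A"
    and polytope: "newton_polytope A = (\<Inter>k\<in>{1..N}. {\<sigma>. pairing (\<mu> k) \<sigma> \<ge> of_int (\<nu> k)})"
    and c_pos: "c > 0"
    and lower: "\<And>x. c * (\<Sum>\<alpha>\<in>A. exp_weight \<alpha> x) \<le> norm (laurent a A (complex_vec (exp_vec x)))"
    and A_nonempty: "A \<noteq> {}"
begin

definition E :: "real ^ 'n \<Rightarrow> complex" where
  "E x = laurent a A (complex_vec (exp_vec x))"

lemma E_eq: "E x = (\<Sum>\<alpha>\<in>A. a \<alpha> * exp (cpair (lattice_vec \<alpha>) x))"
  by (simp add: E_def laurent_exp_vec exp_weight_def cpair_lattice_vec exp_of_real)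

lemma sum_exp_weight_pos: "(\<Sum>\<alpha>\<in>A. exp_weight \<alpha> x) > 0"
  using finite_A A_nonempty by (intro sum_pos) auto

lemma E_nonzero: "E x \<noteq> 0"
  using lower[of x] mult_pos_pos[OF c_pos sum_exp_weight_pos[of x]] by (auto simp: E_def)

definition K :: "nat \<Rightarrow> complex ^ 'n \<Rightarrow> real ^ 'n \<Rightarrow> complex" where
  "K m s x = exp (cpair s x) / E x ^ m"

definition I :: "nat \<Rightarrow> complex ^ 'n \<Rightarrow> complex" where
  "I m s = integral\<^sup>L lborel (K m s)"

lemma K_measurable [measurable]: "K m s \<in> borel_measurable borel"
proof -
  have "continuous_on UNIV E" unfolding E_eq by (intro continuous_intros)
  thus ?thesis unfolding K_def
    by (intro borel_measurable_continuous_onI continuous_intros) (auto simp: E_nonzero)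
qed

text \<open>For \<open>m > 0\<close>, the real part of \<open>s\<close> lies in the
  \<open>m\<close>-fold dilate of the polytope and on none of the hyperplanes bounding it.\<close>

definition region :: "nat \<Rightarrow> (complex ^ 'n) set" where
  "region m = {s. \<forall>k\<in>{1..N}. of_nat m * of_int (\<nu> k) < Re (pairing (\<mu> k) s)}"

lemma real_vec_in_polytope: "\<alpha> \<in> A \<Longrightarrow> real_vec \<alpha> \<in> newton_polytope A"
  by (auto simp: newton_polytope_def intro: hull_inc)

lemma pairing_ge: "\<alpha> \<in> A \<Longrightarrow> k \<in> {1..N} \<Longrightarrow> pairing (\<mu> k) \<alpha> \<ge> \<nu> k"
  using real_vec_in_polytope[of \<alpha>] by (auto simp: polytope pairing_real inner_real_vec inner_commute)

text \<open>A shift by an exponent gains at least \<open>\<nu> k\<close> in direction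
  \<open>k\<close>, which is what the bound for \<open>Suc m\<close> asks in addition.\<close>

lemma region_add:
  assumes "s \<in> region m" "\<alpha> \<in> A"
  shows "s + lattice_vec \<alpha> \<in> region (Suc m)"
  unfolding region_def
proof (intro CollectI ballI)
  fix k assume k: "k \<in> {1..N}"
  have "of_nat m * of_int (\<nu> k) < Re (pairing (\<mu> k) s)" using assms k by (auto simp: region_def)
  moreover have "real_of_int (\<nu> k) \<le> of_int (pairing (\<mu> k) \<alpha>)" using pairing_ge[OF assms(2) k] by simp
  ultimately show "of_nat (Suc m) * of_int (\<nu> k) < Re (pairing (\<mu> k) (s + lattice_vec \<alpha>))"
    by (simp add: pairing_add pairing_lattice_vec distrib_right)
qed

text \<open>A linear function on a convex hull is at most its maximum over the generators; so the
  sum of monomials also dominates real exponents in the polytope.\<close>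

lemma exp_inner_le:
  assumes "\<sigma> \<in> newton_polytope A"
  shows "exp (\<sigma> \<bullet> x) \<le> (\<Sum>\<alpha>\<in>A. exp_weight \<alpha> x)"
proof -
  let ?S = "\<Sum>\<alpha>\<in>A. exp_weight \<alpha> x"
  have "real_vec ` A \<subseteq> {\<sigma>. x \<bullet> \<sigma> \<le> ln ?S}"
  proof clarify
    fix \<alpha> assume "\<alpha> \<in> A"
    hence "exp (real_vec \<alpha> \<bullet> x) \<le> ?S"
      using member_le_sum[of \<alpha> A "\<lambda>\<alpha>. exp_weight \<alpha> x"] finite_A by (simp add: exp_weight_def)
    thus "x \<bullet> real_vec \<alpha> \<le> ln ?S" using sum_exp_weight_pos[of x] by (simp add: ln_ge_iff inner_commute)
  qed
  hence "newton_polytope A \<subseteq> {\<sigma>. x \<bullet> \<sigma> \<le> ln ?S}"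
    unfolding newton_polytope_def by (intro hull_minimal convex_halfspace_le)
  thus ?thesis using assms sum_exp_weight_pos[of x] by (auto simp: ln_ge_iff inner_commute)
qed

text \<open>The strict inequalities leave room to move \<open>Re_vec s\<close> by a distance
  \<open>e\<close> in any direction within the dilated polytope. Moving it towards \<open>x\<close>
  improves the lower bound for the denominator by the factor
  \<open>exp (e * norm x)\<close>.\<close>

lemma K_decay:
  assumes "m > 0" "s \<in> region m"
  obtains C e where "C > 0" "e > 0" "\<And>x. norm (K m s x) \<le> C * exp (- e * norm x)"
proof -
  have "\<forall>\<^sub>F e in at_right (0::real). \<forall>k\<in>{1..N}. e * norm (real_vec (\<mu> k)) < Re (pairing (\<mu> k) s) - of_nat m * of_int (\<nu> k)"
  proof (intro eventually_ball_finite ballI)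
    fix k assume "k \<in> {1..N}"
    hence pos: "0 < Re (pairing (\<mu> k) s) - of_nat m * of_int (\<nu> k)" using assms by (auto simp: region_def)
    have "((\<lambda>e::real. e * norm (real_vec (\<mu> k))) \<longlongrightarrow> 0 * norm (real_vec (\<mu> k))) (at_right 0)"
      by (intro tendsto_intros)
    thus "\<forall>\<^sub>F e in at_right (0::real). e * norm (real_vec (\<mu> k)) < Re (pairing (\<mu> k) s) - of_nat m * of_int (\<nu> k)"
      using pos by (intro order_tendstoD(2)) auto
  qed auto
  moreover have "\<forall>\<^sub>F e in at_right (0::real). e > 0" by (simp add: eventually_at_right_less)
  ultimately have "\<forall>\<^sub>F e in at_right (0::real). e > 0 \<and> (\<forall>k\<in>{1..N}. e * norm (real_vec (\<mu> k)) < Re (pairing (\<mu> k) s) - of_nat m * of_int (\<nu> k))"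
    by eventually_elim auto
  hence "\<exists>e::real. e > 0 \<and> (\<forall>k\<in>{1..N}. e * norm (real_vec (\<mu> k)) < Re (pairing (\<mu> k) s) - of_nat m * of_int (\<nu> k))"
    by (rule eventually_happens'[OF trivial_limit_at_right_real])
  then obtain e :: real where e: "e > 0"
    "\<And>k. k \<in> {1..N} \<Longrightarrow> e * norm (real_vec (\<mu> k)) < Re (pairing (\<mu> k) s) - of_nat m * of_int (\<nu> k)"
    by blast
  show ?thesis
  proof (rule that)
    show "inverse (c ^ m) > 0" "e > 0" using c_pos e by auto
    fix x :: "real ^ 'n"
    \<comment> \<open>The displacement of length \<open>e\<close> towards \<open>x\<close>; at
      \<open>x = 0\<close> it is 0, which satisfies the same bounds.\<close>
    define v where "v = (e / norm x) *\<^sub>R x"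
    \<comment> \<open>Division by \<open>m\<close> returns to the polytope itself and is undone by
      the \<open>m\<close>-th power below.\<close>
    define \<sigma> where "\<sigma> = (1 / real m) *\<^sub>R (Re_vec s + v)"
    have v: "norm v \<le> e" using e(1) by (simp add: v_def)
    have vx: "v \<bullet> x = e * norm x" by (cases "x = 0") (simp_all add: v_def dot_square_norm power2_eq_square)
    have "\<sigma> \<in> newton_polytope A"
      unfolding polytope
    proof (intro INT_I CollectI)
      fix k assume k: "k \<in> {1..N}"
      have "\<bar>real_vec (\<mu> k) \<bullet> v\<bar> \<le> norm (real_vec (\<mu> k)) * norm v" by (rule Cauchy_Schwarz_ineq2)
      also have "\<dots> \<le> norm (real_vec (\<mu> k)) * e" using v by (intro mult_left_mono) auto
      finally have "of_int (\<nu> k) * real m \<le> real_vec (\<mu> k) \<bullet> (Re_vec s + v)"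
        using e(2)[OF k] by (simp add: inner_add_right Re_pairing mult.commute)
      thus "of_int (\<nu> k) \<le> pairing (\<mu> k) \<sigma>"
        using assms(1) by (simp add: \<sigma>_def pairing_real pos_le_divide_eq)
    qed
    from exp_inner_le[OF this, of x] have "exp (\<sigma> \<bullet> x) ^ m \<le> (\<Sum>\<alpha>\<in>A. exp_weight \<alpha> x) ^ m"
      by (intro power_mono) auto
    also have "exp (\<sigma> \<bullet> x) ^ m = exp (Re_vec s \<bullet> x) * exp (e * norm x)"
      using assms(1) by (simp add: \<sigma>_def inner_add_left vx exp_add flip: exp_of_nat_mult)
    also have "(\<Sum>\<alpha>\<in>A. exp_weight \<alpha> x) ^ m \<le> (norm (E x) / c) ^ m"
      using lower[of x] c_pos sum_exp_weight_pos[of x]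
      by (intro power_mono) (auto simp: pos_le_divide_eq mult.commute E_def)
    finally have "exp (Re_vec s \<bullet> x) \<le> norm (E x) ^ m * (inverse (c ^ m) * exp (- e * norm x))"
      using c_pos by (simp add: exp_minus power_divide divide_simps mult_ac)
    thus "norm (K m s x) \<le> inverse (c ^ m) * exp (- e * norm x)"
      using E_nonzero[of x] by (simp add: K_def norm_divide norm_power Re_cpair pos_divide_le_eq mult_ac)
  qed
qed

lemma integrable_of_decay:
  fixes f :: "real ^ 'n \<Rightarrow> complex"
  assumes "f \<in> borel_measurable borel" "e > 0" "\<And>x. norm (f x) \<le> C * exp (- e * norm x)"
  shows "integrable lborel f"
proof (rule Bochner_Integration.integrable_bound)
  show "integrable lborel (\<lambda>x :: real ^ 'n. C * exp (- e * norm x))"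
    using integrable_exp_minus_norm[OF assms(2)] by (intro integrable_mult_right) auto
  show "AE x in lborel. norm (f x) \<le> norm (C * exp (- e * norm x))"
    using order_trans[OF assms(3) abs_ge_self] by (intro AE_I2) simp
qed (use assms in auto)

lemma K_integrable: "m > 0 \<Longrightarrow> s \<in> region m \<Longrightarrow> integrable lborel (K m s)"
  by (metis K_decay K_measurable integrable_of_decay)

text \<open>Multiply numerator and denominator by \<open>E x\<close> and expand the numerator. This
  lifts \<open>K m\<close> to the level \<open>Suc m\<close>, where its derivatives also
  live.\<close>

lemma K_eq_sum: "K m s x = (\<Sum>\<alpha>\<in>A. a \<alpha> * K (Suc m) (s + lattice_vec \<alpha>) x)"
proof -
  have "(\<Sum>\<alpha>\<in>A. a \<alpha> * K (Suc m) (s + lattice_vec \<alpha>) x) = exp (cpair s x) * E x / E x ^ Suc m"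
    by (simp add: K_def E_eq[of x] cpair_add_left exp_add sum_distrib_left sum_divide_distrib mult_ac)
  thus ?thesis using E_nonzero[of x] by (simp add: K_def)
qed

lemma I_eq_sum:
  assumes "m > 0" "s \<in> region m"
  shows "I m s = (\<Sum>\<alpha>\<in>A. a \<alpha> * I (Suc m) (s + lattice_vec \<alpha>))"
proof -
  have "integrable lborel (\<lambda>x. a \<alpha> * K (Suc m) (s + lattice_vec \<alpha>) x)" if "\<alpha> \<in> A" for \<alpha>
    using K_integrable[OF _ region_add[OF assms(2) that]] by (intro integrable_mult_right) auto
  thus ?thesis unfolding I_def K_eq_sum[of m s] by (subst Bochner_Integration.integral_sum) auto
qed

end

section \<open>Holomorphy and integration by parts\<close>

lemma Re_pairing_continuous: "continuous_on S (\<lambda>s. Re (pairing \<kappa> s))"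
  unfolding pairing_def by (intro continuous_intros)

context mellin_data begin

text \<open>The candidate for the derivative is the integral of \<open>K m s x * cpair h x\<close>.
  The remainder is controlled by the second-order Taylor estimate for exp of
  \<open>cpair h x\<close>.\<close>

lemma I_has_derivative:
  assumes "m > 0" "s \<in> region m"
  shows "\<exists>L. (I m has_derivative L) (at s) \<and> (\<forall>c v. L (c *s v) = c * L v)"
proof -
  obtain C e where "C > 0" "e > 0" and decay: "\<And>x. norm (K m s x) \<le> C * exp (- e * norm x)"
    using K_decay[OF assms] by metis
  \<comment> \<open>One quarter of the rate absorbs the shift \<open>h\<close> and another the
    quadratic factor; the majorant \<open>w\<close> keeps the remaining half.\<close>
  define d where "d = e / 4"
  have d: "d > 0" "e = 4 * d" using \<open>e > 0\<close> by (auto simp: d_def)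
  define B where "B = 2 / d\<^sup>2 * C"
  have B: "B \<ge> 0" using \<open>C > 0\<close> by (simp add: B_def)
  define w where "w x = B * exp (- (2 * d) * norm x)" for x :: "real ^ 'n"
  have w: "integrable lborel w"
    unfolding w_def using integrable_exp_minus_norm[of "2 * d"] d by (intro integrable_mult_right) auto
  have coord: "integrable lborel (\<lambda>x. K m s x * complex_of_real (x $ j))" for j
  proof (rule integrable_of_decay)
    show "norm (K m s x * complex_of_real (x $ j)) \<le> C * (1 / d) * exp (- (3 * d) * norm x)" for x
    proof -
      have "d * norm x \<le> exp (d * norm x)" using exp_ge_add_one_self[of "d * norm x"] by linarith
      hence "norm x \<le> 1 / d * exp (d * norm x)" using d by (simp add: field_simps)
      hence *: "\<bar>x $ j\<bar> \<le> 1 / d * exp (d * norm x)" using component_le_norm_cart[of x j] by linarith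
      have "norm (K m s x * complex_of_real (x $ j)) \<le> (C * exp (- e * norm x)) * (1 / d * exp (d * norm x))"
        unfolding norm_mult norm_of_real using decay[of x] * \<open>C > 0\<close> by (intro mult_mono) auto
      also have "\<dots> = C * (1 / d) * exp (- e * norm x + d * norm x)" by (simp only: exp_add mult_ac)
      finally show ?thesis by (simp add: d(2) algebra_simps)
    qed
  qed (use d in auto)
  define D where "D j = (\<integral>x. K m s x * complex_of_real (x $ j) \<partial>lborel)" for j
  \<comment> \<open>Written in coordinates, so that boundedness and complex linearity are evident;
    \<open>L_eq\<close> restores the integral.\<close>
  define L where "L h = (\<Sum>j\<in>UNIV. h $ j * D j)" for h
  have L_eq: "L h = (\<integral>x. K m s x * cpair h x \<partial>lborel)"
    and L_int: "integrable lborel (\<lambda>x. K m s x * cpair h x)" for h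
  proof -
    have int: "integrable lborel (\<lambda>x. h $ j * (K m s x * complex_of_real (x $ j)))" for j
      using coord[of j] by (intro integrable_mult_right) auto
    have eq: "K m s x * cpair h x = (\<Sum>j\<in>UNIV. h $ j * (K m s x * complex_of_real (x $ j)))" for x
      by (simp add: cpair_def sum_distrib_left mult_ac)
    show "L h = (\<integral>x. K m s x * cpair h x \<partial>lborel)"
      unfolding eq using int by (subst Bochner_Integration.integral_sum) (auto simp: L_def D_def)
    show "integrable lborel (\<lambda>x. K m s x * cpair h x)"
      unfolding eq using int by (intro Bochner_Integration.integrable_sum) auto
  qed
  have K_shift: "K m (s + h) x = K m s x * exp (cpair h x)" for h x
    by (simp add: K_def cpair_add_left exp_add)
  have "(I m has_derivative L) (at s)"
  proof (rule has_derivative_quadratic_remainder)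
    have "bounded_linear (\<lambda>h :: complex ^ 'n. h $ j * D j)" for j
      by (intro bounded_linear_compose[OF bounded_linear_mult_left] bounded_linear_vec_nth)
    thus "bounded_linear L" unfolding L_def by (intro bounded_linear_sum) auto
    show "d > 0" by fact
    fix h :: "complex ^ 'n" assume h: "norm h \<le> d"
    have hx: "norm (cpair h x) \<le> d * norm x" for x
      using norm_cpair_le[of h x] mult_right_mono[OF h norm_ge_zero[of x]] by linarith
    have "integrable lborel (K m (s + h))"
    proof (rule integrable_of_decay)
      show "norm (K m (s + h) x) \<le> C * exp (- (3 * d) * norm x)" for x
      proof -
        have "Re (cpair h x) \<le> d * norm x" using hx[of x] complex_Re_le_cmod[of "cpair h x"] by linarith
        hence "norm (K m (s + h) x) \<le> (C * exp (- e * norm x)) * exp (d * norm x)"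
          unfolding K_shift norm_mult norm_exp_eq_Re using decay[of x] \<open>C > 0\<close> by (intro mult_mono) auto
        also have "\<dots> = C * exp (- e * norm x + d * norm x)" by (simp only: exp_add mult_ac)
        finally show ?thesis by (simp add: d(2) algebra_simps)
      qed
    qed (use d in auto)
    hence "I m (s + h) - I m s - L h = (\<integral>x. K m (s + h) x - K m s x - K m s x * cpair h x \<partial>lborel)"
      using K_integrable[OF assms] L_int[of h] by (simp add: I_def L_eq)
    also have "norm \<dots> \<le> (\<integral>x. (norm h)\<^sup>2 * w x \<partial>lborel)"
    proof (rule Bochner_Integration.integral_norm_bound_integral)
      show "integrable lborel (\<lambda>x. K m (s + h) x - K m s x - K m s x * cpair h x)"
        using \<open>integrable lborel (K m (s + h))\<close> K_integrable[OF assms] L_int[of h] by auto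
      show "integrable lborel (\<lambda>x. (norm h)\<^sup>2 * w x)" using w by (intro integrable_mult_right) auto
      fix x :: "real ^ 'n"
      let ?z = "cpair h x"
      have "norm (exp ?z - 1 - ?z) \<le> exp \<bar>Re ?z\<bar> * (norm ?z)\<^sup>2"
        using Taylor_exp[of ?z 1] by (simp add: power2_eq_square diff_diff_eq)
      also have "\<dots> \<le> exp (d * norm x) * (norm h * norm x)\<^sup>2"
        using order_trans[OF abs_Re_le_cmod hx] norm_cpair_le[of h x] by (intro mult_mono power_mono) auto
      also have "\<dots> \<le> exp (d * norm x) * ((norm h)\<^sup>2 * (2 / d\<^sup>2 * exp (d * norm x)))"
        unfolding power_mult_distrib using quadratic_le_exp[of d "norm x"] d by (intro mult_left_mono) auto
      finally have taylor: "norm (exp ?z - 1 - ?z) \<le> exp (d * norm x) * ((norm h)\<^sup>2 * (2 / d\<^sup>2 * exp (d * norm x)))" .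
      have "K m (s + h) x - K m s x - K m s x * ?z = K m s x * (exp ?z - 1 - ?z)"
        by (simp add: K_shift right_diff_distrib)
      also have "norm \<dots> \<le> (C * exp (- e * norm x)) * (exp (d * norm x) * ((norm h)\<^sup>2 * (2 / d\<^sup>2 * exp (d * norm x))))"
        unfolding norm_mult using decay[of x] taylor \<open>C > 0\<close> by (intro mult_mono) auto
      also have "\<dots> = (norm h)\<^sup>2 * (B * exp (- e * norm x + d * norm x + d * norm x))"
        by (simp only: exp_add B_def mult_ac)
      finally show "norm (K m (s + h) x - K m s x - K m s x * ?z) \<le> (norm h)\<^sup>2 * w x"
        by (simp add: w_def d(2) algebra_simps)
    qed
    also have "\<dots> = integral\<^sup>L lborel w * (norm h)\<^sup>2" by simp
    finally show "norm (I m (s + h) - I m s - L h) \<le> integral\<^sup>L lborel w * (norm h)\<^sup>2" .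
  qed
  moreover have "L (c *s v) = c * L v" for c v
    by (simp add: L_def sum_distrib_left mult_ac)
  ultimately show ?thesis by blast
qed

lemma E_has_vector_derivative:
  "((\<lambda>t. E (x + t *\<^sub>R real_vec \<kappa>)) has_vector_derivative
    (\<Sum>\<alpha>\<in>A. a \<alpha> * of_int (pairing \<kappa> \<alpha>) * exp (cpair (lattice_vec \<alpha>) (x + t *\<^sub>R real_vec \<kappa>)))) (at t)"
proof -
  have "cpair (lattice_vec \<alpha>) (x + t *\<^sub>R real_vec \<kappa>) = cpair (lattice_vec \<alpha>) x + of_real t * of_int (pairing \<kappa> \<alpha>)" for \<alpha> t
    by (simp add: cpair_add_right cpair_scaleR_right cpair_real_vec pairing_lattice_vec)
  thus ?thesis unfolding E_eq
    by (auto intro!: derivative_eq_intros has_vector_derivative_real_field sum.cong simp: mult_ac)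
qed

text \<open>Quotient rule along the line. Differentiating \<open>E\<close> multiplies the
  coefficient of \<alpha> by \<open>pairing \<kappa> \<alpha>\<close>, so each term of the second
  part is again a translate on level \<open>Suc m\<close>.\<close>

lemma K_has_vector_derivative:
  "((\<lambda>t. K m s (x + t *\<^sub>R real_vec \<kappa>)) has_vector_derivative
    (pairing \<kappa> s * K m s (x + t *\<^sub>R real_vec \<kappa>)
      - of_nat m * (\<Sum>\<alpha>\<in>A. a \<alpha> * of_int (pairing \<kappa> \<alpha>) * K (Suc m) (s + lattice_vec \<alpha>) (x + t *\<^sub>R real_vec \<kappa>)))) (at t)"
proof -
  let ?y = "x + t *\<^sub>R real_vec \<kappa>"
  define E' where "E' = (\<Sum>\<alpha>\<in>A. a \<alpha> * of_int (pairing \<kappa> \<alpha>) * exp (cpair (lattice_vec \<alpha>) ?y))"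
  define X where "X = exp (cpair s ?y)"
  have "((\<lambda>t. exp (cpair s x + of_real t * pairing \<kappa> s)) has_vector_derivative
      pairing \<kappa> s * exp (cpair s x + of_real t * pairing \<kappa> s)) (at t)"
    by (rule has_vector_derivative_real_field) (auto intro!: derivative_eq_intros)
  hence num: "((\<lambda>t. exp (cpair s (x + t *\<^sub>R real_vec \<kappa>))) has_vector_derivative pairing \<kappa> s * X) (at t)"
    by (simp add: cpair_add_right cpair_scaleR_right cpair_real_vec X_def)
  have den: "((\<lambda>t. inverse (E (x + t *\<^sub>R real_vec \<kappa>) ^ m)) has_vector_derivative
      E' * (- of_nat m * inverse (E ?y ^ Suc m))) (at t)"
  proof -
    have "((\<lambda>z. z ^ m) has_field_derivative of_nat m * E ?y ^ (m - 1)) (at (E ?y))"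
      using DERIV_power[OF DERIV_ident, of m "E ?y" UNIV] by simp
    moreover have "E ?y ^ m \<noteq> 0" using E_nonzero by simp
    ultimately have "((\<lambda>z. inverse (z ^ m)) has_field_derivative
        - (of_nat m * E ?y ^ (m - 1) * inverse ((E ?y ^ m) ^ Suc (Suc 0)))) (at (E ?y))"
      by (rule DERIV_inverse_fun)
    \<comment> \<open>For \<open>m = 0\<close> the natural number \<open>m - 1\<close> is truncated
      to 0, but the factor \<open>of_nat m\<close> makes both sides vanish.\<close>
    moreover have "- (of_nat m * E ?y ^ (m - 1) * inverse ((E ?y ^ m) ^ Suc (Suc 0)))
        = - of_nat m * inverse (E ?y ^ Suc m)"
      using E_nonzero[of ?y] by (cases m) (simp_all add: field_simps)
    ultimately have "((\<lambda>z. inverse (z ^ m)) has_field_derivative - of_nat m * inverse (E ?y ^ Suc m)) (at (E ?y))"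
      by (simp only:)
    from field_vector_diff_chain_at[OF E_has_vector_derivative[of x \<kappa> t, folded E'_def] this]
    show ?thesis by (simp add: o_def)
  qed
  have sum_eq: "(\<Sum>\<alpha>\<in>A. a \<alpha> * of_int (pairing \<kappa> \<alpha>) * K (Suc m) (s + lattice_vec \<alpha>) ?y) = X * E' * inverse (E ?y ^ Suc m)"
    by (simp add: K_def cpair_add_left exp_add E'_def X_def sum_distrib_left sum_distrib_right divide_inverse mult_ac
        del: power_Suc)
  have "((\<lambda>t. exp (cpair s (x + t *\<^sub>R real_vec \<kappa>)) * inverse (E (x + t *\<^sub>R real_vec \<kappa>) ^ m)) has_vector_derivative
     X * (E' * (- of_nat m * inverse (E ?y ^ Suc m))) + pairing \<kappa> s * X * inverse (E ?y ^ m)) (at t)"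
    using has_vector_derivative_mult[OF num den] by (simp only: X_def)
  moreover have "X * (E' * (- of_nat m * inverse (E ?y ^ Suc m))) + pairing \<kappa> s * X * inverse (E ?y ^ m)
    = pairing \<kappa> s * K m s ?y - of_nat m * (X * E' * inverse (E ?y ^ Suc m))"
    by (simp add: K_def X_def divide_inverse algebra_simps del: power_Suc)
  ultimately show ?thesis unfolding sum_eq by (simp only: K_def divide_inverse)
qed

text \<open>The terms may decay at different rates; the smallest rate serves for the sum.\<close>

lemma decay_lincomb:
  fixes f :: "'i \<Rightarrow> real ^ 'n \<Rightarrow> complex"
  assumes "finite J" "\<And>i. i \<in> J \<Longrightarrow> \<exists>C e. C > 0 \<and> e > 0 \<and> (\<forall>x. norm (f i x) \<le> C * exp (- e * norm x))"
  shows "\<exists>C e. C > 0 \<and> e > 0 \<and> (\<forall>x. norm (\<Sum>i\<in>J. b i * f i x) \<le> C * exp (- e * norm x))"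
  using assms
proof (induction J)
  case empty
  show ?case by (intro exI[of _ 1]) auto
next
  case (insert j J)
  then obtain C e where 1: "C > 0" "e > 0" "\<And>x. norm (\<Sum>i\<in>J. b i * f i x) \<le> C * exp (- e * norm x)"
    by auto
  obtain C' e' where 2: "C' > 0" "e' > 0" "\<And>x. norm (f j x) \<le> C' * exp (- e' * norm x)"
    using insert.prems[of j] by auto
  have "norm (\<Sum>i\<in>insert j J. b i * f i x) \<le> (norm (b j) * C' + C) * exp (- min e e' * norm x)" for x
  proof -
    have "norm (\<Sum>i\<in>insert j J. b i * f i x) \<le> norm (b j) * norm (f j x) + norm (\<Sum>i\<in>J. b i * f i x)"
      using insert.hyps by (simp add: norm_triangle_ineq flip: norm_mult)
    also have "\<dots> \<le> norm (b j) * (C' * exp (- e' * norm x)) + C * exp (- e * norm x)"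
      using 1 2 by (intro add_mono mult_left_mono) auto
    also have "\<dots> \<le> norm (b j) * (C' * exp (- min e e' * norm x)) + C * exp (- min e e' * norm x)"
    proof (intro add_mono mult_left_mono)
      show "exp (- e' * norm x) \<le> exp (- min e e' * norm x)" "exp (- e * norm x) \<le> exp (- min e e' * norm x)"
        unfolding exp_le_cancel_iff by (intro mult_right_mono; simp)+
    qed (use 1 2 in auto)
    finally show ?thesis by (simp add: algebra_simps)
  qed
  moreover have "norm (b j) * C' + C > 0" "min e e' > 0"
    using 1 2 by (auto intro: add_nonneg_pos)
  ultimately show ?case by blast
qed

text \<open>The derivative of \<open>K m s\<close> in direction \<kappa> integrates to 0, which is
  the integration by parts behind the continuation.\<close>

lemma pairing_times_I:
  assumes "m > 0" "s \<in> region m"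
  shows "pairing \<kappa> s * I m s = of_nat m * (\<Sum>\<alpha>\<in>A. a \<alpha> * of_int (pairing \<kappa> \<alpha>) * I (Suc m) (s + lattice_vec \<alpha>))"
proof -
  have "\<exists>C e. C > 0 \<and> e > 0 \<and> (\<forall>x. norm (\<Sum>\<alpha>\<in>A. (pairing \<kappa> s * a \<alpha> - of_nat m * a \<alpha> * of_int (pairing \<kappa> \<alpha>)) * K (Suc m) (s + lattice_vec \<alpha>) x)
      \<le> C * exp (- e * norm x))"
    using K_decay[OF _ region_add[OF assms(2)]] by (intro decay_lincomb finite_A) blast
  moreover define D where "D x = pairing \<kappa> s * K m s x
      - of_nat m * (\<Sum>\<alpha>\<in>A. a \<alpha> * of_int (pairing \<kappa> \<alpha>) * K (Suc m) (s + lattice_vec \<alpha>) x)" for x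
  \<comment> \<open>With \<open>K m s\<close> lifted by \<open>K_eq_sum\<close>, \<open>D\<close> is
    one linear combination on level \<open>Suc m\<close>, and its decay follows termwise.\<close>
  have "D x = (\<Sum>\<alpha>\<in>A. (pairing \<kappa> s * a \<alpha> - of_nat m * a \<alpha> * of_int (pairing \<kappa> \<alpha>)) * K (Suc m) (s + lattice_vec \<alpha>) x)" for x
    unfolding D_def by (subst K_eq_sum)
      (simp add: sum_distrib_left left_diff_distrib mult.assoc flip: sum_subtractf)
  ultimately obtain C e where "e > 0" "\<And>x. norm (D x) \<le> C * exp (- e * norm x)" by metis
  moreover have "((\<lambda>t. K m s (x + t *\<^sub>R real_vec \<kappa>)) has_vector_derivative D (x + t *\<^sub>R real_vec \<kappa>)) (at t)" for x t
    unfolding D_def by (rule K_has_vector_derivative)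
  moreover have "D \<in> borel_measurable borel" unfolding D_def by measurable
  ultimately have "integral\<^sup>L lborel D = 0"
    using integral_directional_derivative_eq_0[OF K_integrable[OF assms]] by blast
  moreover have int: "integrable lborel (K (Suc m) (s + lattice_vec \<alpha>))" if "\<alpha> \<in> A" for \<alpha>
    using K_integrable[OF _ region_add[OF assms(2) that]] by simp
  have "integral\<^sup>L lborel D = pairing \<kappa> s * I m s - of_nat m * (\<Sum>\<alpha>\<in>A. a \<alpha> * of_int (pairing \<kappa> \<alpha>) * I (Suc m) (s + lattice_vec \<alpha>))"
  proof -
    have 1: "integrable lborel (\<lambda>x. pairing \<kappa> s * K m s x)"
      using K_integrable[OF assms] by (intro integrable_mult_right) auto
    have 2: "integrable lborel (\<lambda>x. of_nat m * (\<Sum>\<alpha>\<in>A. a \<alpha> * of_int (pairing \<kappa> \<alpha>) * K (Suc m) (s + lattice_vec \<alpha>) x))"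
      using int by (intro integrable_mult_right Bochner_Integration.integrable_sum) auto
    show ?thesis unfolding D_def Bochner_Integration.integral_diff[OF 1 2] integral_mult_right_zero I_def
      using int by (subst Bochner_Integration.integral_sum) auto
  qed
  ultimately show ?thesis by simp
qed

end

section \<open>Continuation\<close>

lemma holomorphic_Cn_const: "holomorphic_Cn_on (\<lambda>s. w) U"
  unfolding holomorphic_Cn_on_def by (intro ballI exI[of _ "\<lambda>_. 0"]) auto

lemma holomorphic_Cn_add:
  assumes "holomorphic_Cn_on f U" "holomorphic_Cn_on g U"
  shows "holomorphic_Cn_on (\<lambda>s. f s + g s) U"
  unfolding holomorphic_Cn_on_def
proof
  fix s assume "s \<in> U"
  then obtain L M where "(f has_derivative L) (at s)" "\<forall>c v. L (c *s v) = c * L v"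
    "(g has_derivative M) (at s)" "\<forall>c v. M (c *s v) = c * M v"
    using assms unfolding holomorphic_Cn_on_def by blast
  thus "\<exists>L. ((\<lambda>s. f s + g s) has_derivative L) (at s) \<and> (\<forall>c v. L (c *s v) = c * L v)"
    by (intro exI[of _ "\<lambda>h. L h + M h"]) (auto intro: has_derivative_add simp: distrib_left)
qed

lemma holomorphic_Cn_mult:
  assumes "holomorphic_Cn_on f U" "holomorphic_Cn_on g U"
  shows "holomorphic_Cn_on (\<lambda>s. f s * g s) U"
  unfolding holomorphic_Cn_on_def
proof
  fix s assume "s \<in> U"
  then obtain L M where "(f has_derivative L) (at s)" "\<forall>c v. L (c *s v) = c * L v"
    "(g has_derivative M) (at s)" "\<forall>c v. M (c *s v) = c * M v"
    using assms unfolding holomorphic_Cn_on_def by blast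
  thus "\<exists>L. ((\<lambda>s. f s * g s) has_derivative L) (at s) \<and> (\<forall>c v. L (c *s v) = c * L v)"
    by (intro exI[of _ "\<lambda>h. f s * M h + L h * g s"] conjI has_derivative_mult) (auto simp: algebra_simps)
qed

lemma holomorphic_Cn_prod:
  assumes "\<And>i. i \<in> J \<Longrightarrow> holomorphic_Cn_on (f i) U"
  shows "holomorphic_Cn_on (\<lambda>s. \<Prod>i\<in>J. f i s) U"
  using assms
  by (induction J rule: infinite_finite_induct) (auto intro: holomorphic_Cn_const holomorphic_Cn_mult)

lemma holomorphic_Cn_compose:
  assumes f: "holomorphic_Cn_on f U" and g: "\<And>z. \<exists>d. (g has_field_derivative d) (at z)"
  shows "holomorphic_Cn_on (\<lambda>s. g (f s)) U"
  unfolding holomorphic_Cn_on_def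
proof
  fix s assume "s \<in> U"
  then obtain L where L: "(f has_derivative L) (at s)" "\<forall>c v. L (c *s v) = c * L v"
    using f unfolding holomorphic_Cn_on_def by blast
  obtain d where "(g has_field_derivative d) (at (f s))" using g by blast
  hence "((\<lambda>s. g (f s)) has_derivative (\<lambda>h. d * L h)) (at s)"
    using has_derivative_compose[OF L(1)] by (auto simp: has_field_derivative_def)
  thus "\<exists>L. ((\<lambda>s. g (f s)) has_derivative L) (at s) \<and> (\<forall>c v. L (c *s v) = c * L v)"
    using L(2) by (intro exI[of _ "\<lambda>h. d * L h"]) auto
qed

lemma holomorphic_Cn_pairing:
  fixes \<kappa> :: "int ^ 'n"
  shows "holomorphic_Cn_on (pairing \<kappa>) U"
  unfolding holomorphic_Cn_on_def
proof (intro ballI exI conjI allI)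
  have "bounded_linear (\<lambda>s :: complex ^ 'n. of_int (\<kappa> $ j) * s $ j)" for j
    by (intro bounded_linear_compose[OF bounded_linear_mult_right] bounded_linear_vec_nth)
  hence "bounded_linear (\<lambda>s :: complex ^ 'n. pairing \<kappa> s)"
    unfolding pairing_def by (intro bounded_linear_sum) auto
  thus "(pairing \<kappa> has_derivative pairing \<kappa>) (at s)" for s :: "complex ^ 'n"
    by (rule bounded_linear_imp_has_derivative)
  show "pairing \<kappa> (c *s v) = c * pairing \<kappa> v" for c :: complex and v
    by (simp add: pairing_def sum_distrib_left mult_ac)
qed

lemma holomorphic_Cn_rGamma_pairing: "holomorphic_Cn_on (\<lambda>s. rGamma (pairing \<kappa> s + w)) U"
  by (rule holomorphic_Cn_compose)
    (use has_field_derivative_rGamma in \<open>auto intro: holomorphic_Cn_add holomorphic_Cn_pairing holomorphic_Cn_const\<close>)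

context mellin_data begin

text \<open>
  The linear span of those translates of \<open>I m\<close> by lattice vectors that converge on the
  whole of \<open>ext_dom l\<close>, defined below.
\<close>

inductive mspan :: "nat \<Rightarrow> (nat \<Rightarrow> nat) \<Rightarrow> (complex ^ 'n \<Rightarrow> complex) \<Rightarrow> bool" for m l where
  zero: "mspan m l (\<lambda>s. 0)"
| step: "mspan m l H \<Longrightarrow> (\<And>j. j \<in> {1..N} \<Longrightarrow> pairing (\<mu> j) \<beta> \<ge> (int m - 1) * \<nu> j + int (l j))
    \<Longrightarrow> mspan m l (\<lambda>s. b * I m (s + lattice_vec \<beta>) + H s)"

text \<open>\<open>l k\<close> counts the units by which the \<open>k\<close>-th bound has been
  relaxed; \<open>l = 0\<close> gives back \<open>region 1\<close>.\<close>

definition ext_dom :: "(nat \<Rightarrow> nat) \<Rightarrow> (complex ^ 'n) set" where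
  "ext_dom l = {s. \<forall>k\<in>{1..N}. of_int (\<nu> k) - real (l k) < Re (pairing (\<mu> k) s)}"

lemma open_ext_dom: "open (ext_dom l)"
proof -
  have "ext_dom l = (\<Inter>k\<in>{1..N}. {s. of_int (\<nu> k) - real (l k) < Re (pairing (\<mu> k) s)})"
    by (auto simp: ext_dom_def)
  thus ?thesis
    by (auto intro!: open_INT open_Collect_less continuous_on_const Re_pairing_continuous)
qed

text \<open>The bounds are demanded only for \<open>b \<noteq> 0\<close>: a translate outside the
  admissible range is allowed if its coefficient cancels.\<close>

lemma mspan_term:
  assumes "b \<noteq> 0 \<Longrightarrow> (\<And>j. j \<in> {1..N} \<Longrightarrow> pairing (\<mu> j) \<beta> \<ge> (int m - 1) * \<nu> j + int (l j))"
  shows "mspan m l (\<lambda>s. b * I m (s + lattice_vec \<beta>))"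
  using assms mspan.zero[of m l] mspan.step[OF mspan.zero[of m l], of \<beta> b] by (cases "b = 0") auto

lemma mspan_add:
  assumes "mspan m l H" "mspan m l H'"
  shows "mspan m l (\<lambda>s. H s + H' s)"
  using assms(1)
proof induction
  case (step H \<beta> b)
  from mspan.step[OF this(3,2)] show ?case by (simp add: add.assoc)
qed (use assms in simp)

lemma mspan_sum: "(\<And>i. i \<in> J \<Longrightarrow> mspan m l (H i)) \<Longrightarrow> mspan m l (\<lambda>s. \<Sum>i\<in>J. H i s)"
  by (induction J rule: infinite_finite_induct) (auto intro: mspan.zero mspan_add)

lemma mspan_cong:
  assumes "mspan m l H" "\<And>j. j \<in> {1..N} \<Longrightarrow> l' j = l j"
  shows "mspan m l' H"
  using assms by induction (auto intro!: mspan.intros)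

text \<open>The bounds add up: (m - 1) \<nu> + l from the shift and \<nu> - l from the domain make m
  \<nu>.\<close>

lemma ext_dom_add_region:
  assumes "s \<in> ext_dom l" "\<And>j. j \<in> {1..N} \<Longrightarrow> pairing (\<mu> j) \<beta> \<ge> (int m - 1) * \<nu> j + int (l j)"
  shows "s + lattice_vec \<beta> \<in> region m"
  unfolding region_def
proof (intro CollectI ballI)
  fix k assume k: "k \<in> {1..N}"
  have "real_of_int ((int m - 1) * \<nu> k + int (l k)) \<le> of_int (pairing (\<mu> k) \<beta>)"
    using assms(2)[OF k] by (simp only: of_int_le_iff)
  moreover have "of_int (\<nu> k) - real (l k) < Re (pairing (\<mu> k) s)" using assms(1) k by (auto simp: ext_dom_def)
  ultimately show "of_nat m * of_int (\<nu> k) < Re (pairing (\<mu> k) (s + lattice_vec \<beta>))"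
    by (simp add: pairing_add pairing_lattice_vec left_diff_distrib)
qed

lemma mspan_holomorphic:
  assumes "mspan m l H" "m > 0"
  shows "holomorphic_Cn_on H (ext_dom l)"
  using assms(1)
proof induction
  case (step H \<beta> b)
  have "holomorphic_Cn_on (\<lambda>s. I m (s + lattice_vec \<beta>)) (ext_dom l)"
    unfolding holomorphic_Cn_on_def
  proof
    fix s assume "s \<in> ext_dom l"
    then obtain L where L: "(I m has_derivative L) (at (s + lattice_vec \<beta>))" "\<forall>c v. L (c *s v) = c * L v"
      using I_has_derivative[OF assms(2) ext_dom_add_region] step(2) by blast
    have "((\<lambda>s. s + lattice_vec \<beta>) has_derivative (\<lambda>h. h)) (at s)"
      by (auto intro!: derivative_eq_intros)
    from has_derivative_compose[OF this L(1)] L(2)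
    show "\<exists>L. ((\<lambda>s. I m (s + lattice_vec \<beta>)) has_derivative L) (at s) \<and> (\<forall>c v. L (c *s v) = c * L v)"
      by blast
  qed
  thus ?case by (intro holomorphic_Cn_add holomorphic_Cn_mult holomorphic_Cn_const step)
qed (rule holomorphic_Cn_const)

text \<open>The linear factor is split into the pairing at the shifted point, which is integrated by
  parts, and a constant, which is expanded by \<open>I_eq_sum\<close>. The identity is claimed where
  the old integrals converge, while \<open>H'\<close> lives on the larger domain and so provides the
  continuation.\<close>

lemma mspan_step:
  assumes "mspan m l H" "m > 0" "k \<in> {1..N}"
  shows "\<exists>H'. mspan (Suc m) (l(k := Suc (l k))) H' \<and>
    (\<forall>s\<in>ext_dom l. H' s = (pairing (\<mu> k) s - of_int (\<nu> k) + of_nat (l k)) * H s)"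
  using assms(1)
proof induction
  case zero
  show ?case by (rule exI[of _ "\<lambda>s. 0"]) (simp add: mspan.zero)
next
  case (step H \<beta> b)
  then obtain H' where H': "mspan (Suc m) (l(k := Suc (l k))) H'"
    "\<forall>s\<in>ext_dom l. H' s = (pairing (\<mu> k) s - of_int (\<nu> k) + of_nat (l k)) * H s" by blast
  define q where "q \<alpha> = int m * pairing (\<mu> k) \<alpha> - pairing (\<mu> k) \<beta> - \<nu> k + int (l k)" for \<alpha>
  define T where "T s = (\<Sum>\<alpha>\<in>A. (b * a \<alpha> * of_int (q \<alpha>)) * I (Suc m) (s + lattice_vec (\<beta> + \<alpha>)))" for s
  text \<open>The weight \<^term>\<open>q \<alpha>\<close> vanishes when both \<open>\<alpha>\<close> and \<open>\<beta>\<close> attain their bounds for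
    \<^term>\<open>\<mu> k\<close>, so one unit is gained in the direction \<open>k\<close>.\<close>
  have "mspan (Suc m) (l(k := Suc (l k))) T"
    unfolding T_def
  proof (intro mspan_sum mspan_term)
    fix \<alpha> j assume \<alpha>: "\<alpha> \<in> A" and nz: "b * a \<alpha> * of_int (q \<alpha>) \<noteq> 0" and j: "j \<in> {1..N}"
    have add: "pairing (\<mu> i) (\<beta> + \<alpha>) = pairing (\<mu> i) \<beta> + pairing (\<mu> i) \<alpha>" for i
      by (rule pairing_add)
    have "pairing (\<mu> k) \<beta> + pairing (\<mu> k) \<alpha> \<noteq> int m * \<nu> k + int (l k)"
    proof
      assume eq: "pairing (\<mu> k) \<beta> + pairing (\<mu> k) \<alpha> = int m * \<nu> k + int (l k)"
      hence \<alpha>\<nu>: "pairing (\<mu> k) \<alpha> = \<nu> k"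
        using pairing_ge[OF \<alpha> assms(3)] step(2)[OF assms(3)] by (simp add: left_diff_distrib)
      hence "q \<alpha> = 0" using eq by (simp add: q_def algebra_simps)
      thus False using nz by simp
    qed
    \<comment> \<open>The pairings are integers, so excluding equality gains a full unit for
      \<open>j = k\<close>; for other \<open>j\<close> the sum of the two lower bounds is
      enough.\<close>
    thus "(int (Suc m) - 1) * \<nu> j + int ((l(k := Suc (l k))) j) \<le> pairing (\<mu> j) (\<beta> + \<alpha>)"
      using pairing_ge[OF \<alpha> j] step(2)[OF j] by (auto simp: add left_diff_distrib)
  qed
  moreover have "T s = (pairing (\<mu> k) s - of_int (\<nu> k) + of_nat (l k)) * (b * I m (s + lattice_vec \<beta>))"
    if "s \<in> ext_dom l" for s
  proof -
    let ?t = "s + lattice_vec \<beta>"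
    have t: "?t \<in> region m" by (rule ext_dom_add_region[OF that step(2)])
    \<comment> \<open>The difference between the wanted linear factor at \<open>s\<close> and the
      pairing at the shifted point \<open>?t\<close>.\<close>
    define w where "w = - of_int (pairing (\<mu> k) \<beta>) - of_int (\<nu> k) + (of_nat (l k) :: complex)"
    have "(pairing (\<mu> k) s - of_int (\<nu> k) + of_nat (l k)) * I m ?t = pairing (\<mu> k) ?t * I m ?t + w * I m ?t"
      by (simp add: pairing_add pairing_lattice_vec w_def algebra_simps)
    also have "\<dots> = of_nat m * (\<Sum>\<alpha>\<in>A. a \<alpha> * of_int (pairing (\<mu> k) \<alpha>) * I (Suc m) (?t + lattice_vec \<alpha>))
        + w * (\<Sum>\<alpha>\<in>A. a \<alpha> * I (Suc m) (?t + lattice_vec \<alpha>))"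
      by (simp only: pairing_times_I[OF assms(2) t] flip: I_eq_sum[OF assms(2) t])
    also have "\<dots> = (\<Sum>\<alpha>\<in>A. (a \<alpha> * of_int (q \<alpha>)) * I (Suc m) (?t + lattice_vec \<alpha>))"
      unfolding sum_distrib_left sum.distrib[symmetric]
      by (intro sum.cong refl) (simp add: q_def w_def algebra_simps)
    finally show ?thesis by (simp add: T_def lattice_vec_add add.assoc sum_distrib_left mult_ac)
  qed
  ultimately show ?case using H'
    by (intro exI[of _ "\<lambda>s. T s + H' s"] conjI mspan_add) (auto simp: distrib_left simp del: fun_upd_apply)
qed

text \<open>One round through all directions. Each direction raises the level by one, hence
  \<open>m + N\<close>.\<close>

lemma mspan_step_all:
  assumes "mspan m (\<lambda>_. r) H" "m > 0"
  shows "\<exists>H'. mspan (m + N) (\<lambda>_. Suc r) H' \<and>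
    (\<forall>s\<in>ext_dom (\<lambda>_. r). H' s = (\<Prod>k\<in>{1..N}. pairing (\<mu> k) s - of_int (\<nu> k) + of_nat r) * H s)"
proof -
  have "\<exists>H'. mspan (m + n) (\<lambda>j. if j \<in> {1..n} then Suc r else r) H' \<and>
      (\<forall>s\<in>ext_dom (\<lambda>_. r). H' s = (\<Prod>k\<in>{1..n}. pairing (\<mu> k) s - of_int (\<nu> k) + of_nat r) * H s)"
    if "n \<le> N" for n
    using that
  proof (induction n)
    case 0
    show ?case using assms(1) by (intro exI[of _ H]) simp
  next
    case (Suc n)
    let ?l = "\<lambda>j. if j \<in> {1..n} then Suc r else r"
    obtain G where G: "mspan (m + n) ?l G"
      "\<forall>s\<in>ext_dom (\<lambda>_. r). G s = (\<Prod>k\<in>{1..n}. pairing (\<mu> k) s - of_int (\<nu> k) + of_nat r) * H s"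
      using Suc by auto
    obtain H' where H': "mspan (Suc (m + n)) (?l(Suc n := Suc (?l (Suc n)))) H'"
      "\<forall>s\<in>ext_dom ?l. H' s = (pairing (\<mu> (Suc n)) s - of_int (\<nu> (Suc n)) + of_nat (?l (Suc n))) * G s"
      using mspan_step[OF G(1), of "Suc n"] Suc.prems assms(2) by auto
    have "mspan (m + Suc n) (\<lambda>j. if j \<in> {1..Suc n} then Suc r else r) H'"
      using mspan_cong[OF H'(1), of "\<lambda>j. if j \<in> {1..Suc n} then Suc r else r"] by simp
    \<comment> \<open>The initial domain of the round lies in every intermediate one, so the factors
      can be multiplied there.\<close>
    moreover have "ext_dom (\<lambda>_. r) \<subseteq> ext_dom ?l" unfolding ext_dom_def by force
    hence "\<forall>s\<in>ext_dom (\<lambda>_. r). H' s = (\<Prod>k\<in>{1..Suc n}. pairing (\<mu> k) s - of_int (\<nu> k) + of_nat r) * H s"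
      using H'(2) G(2) by (auto simp: mult_ac)
    ultimately show ?case by blast
  qed
  from this[OF order_refl] obtain H'
    where "mspan (m + N) (\<lambda>j. if j \<in> {1..N} then Suc r else r) H'"
      "\<forall>s\<in>ext_dom (\<lambda>_. r). H' s = (\<Prod>k\<in>{1..N}. pairing (\<mu> k) s - of_int (\<nu> k) + of_nat r) * H s"
    by blast
  thus ?thesis by (intro exI[of _ H'] conjI) (auto elim: mspan_cong)
qed

lemma mspan_0: "mspan 1 (\<lambda>_. 0) (I 1)"
  using mspan_term[where b = 1 and \<beta> = 0 and m = 1 and l = "\<lambda>_. 0"] by (simp add: lattice_vec_0 pairing_def)

lemma mspan_sequence:
  obtains H where "H 0 = I 1" "\<And>r. mspan (1 + r * N) (\<lambda>_. r) (H r)"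
    "\<And>r s. s \<in> ext_dom (\<lambda>_. r) \<Longrightarrow> H (Suc r) s = (\<Prod>k\<in>{1..N}. pairing (\<mu> k) s - of_int (\<nu> k) + of_nat r) * H r s"
proof -
  have "\<exists>H. \<forall>r. (mspan (1 + r * N) (\<lambda>_. r) (H r) \<and> (r = 0 \<longrightarrow> H r = I 1)) \<and>
     (\<forall>s\<in>ext_dom (\<lambda>_. r). H (Suc r) s = (\<Prod>k\<in>{1..N}. pairing (\<mu> k) s - of_int (\<nu> k) + of_nat r) * H r s)"
  proof (rule dependent_nat_choice)
    show "\<exists>H. mspan (1 + 0 * N) (\<lambda>_. 0) H \<and> (0 = 0 \<longrightarrow> H = I 1)" using mspan_0 by auto
    fix H r assume "mspan (1 + r * N) (\<lambda>_. r) H \<and> (r = 0 \<longrightarrow> H = I 1)"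
    thus "\<exists>H'. (mspan (1 + Suc r * N) (\<lambda>_. Suc r) H' \<and> (Suc r = 0 \<longrightarrow> H' = I 1)) \<and>
      (\<forall>s\<in>ext_dom (\<lambda>_. r). H' s = (\<Prod>k\<in>{1..N}. pairing (\<mu> k) s - of_int (\<nu> k) + of_nat r) * H s)"
      using mspan_step_all[of "1 + r * N" r H] by (auto simp: add_ac)
  qed
  thus ?thesis using that by blast
qed

text \<open>By \<open>rGamma z = z * rGamma (z + 1)\<close>, the linear factors gained by
  \<open>H (Suc r)\<close> are those that \<open>rGamma\<close> loses when its shift grows by one.
  So the products \<open>G r\<close> agree on overlaps and glue to an entire function.\<close>

lemma entire_factor:
  obtains \<Phi> where "holomorphic_Cn_on \<Phi> UNIV"
    "\<And>s. s \<in> ext_dom (\<lambda>_. 0) \<Longrightarrow> \<Phi> s = I 1 s * (\<Prod>k\<in>{1..N}. rGamma (pairing (\<mu> k) s - of_int (\<nu> k)))"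
proof -
  obtain H where H: "H 0 = I 1" "\<And>r. mspan (1 + r * N) (\<lambda>_. r) (H r)"
    "\<And>r s. s \<in> ext_dom (\<lambda>_. r) \<Longrightarrow> H (Suc r) s = (\<Prod>k\<in>{1..N}. pairing (\<mu> k) s - of_int (\<nu> k) + of_nat r) * H r s"
    using mspan_sequence by blast
  define G where "G r s = H r s * (\<Prod>k\<in>{1..N}. rGamma (pairing (\<mu> k) s + (of_nat r - of_int (\<nu> k))))" for r s
  \<comment> \<open>Any admissible \<open>r\<close> would give the same value by
    \<open>G_eq\<close>; the least one only fixes a choice.\<close>
  define \<Phi> where "\<Phi> s = G (LEAST r. s \<in> ext_dom (\<lambda>_. r)) s" for s
  have mono: "ext_dom (\<lambda>_. r) \<subseteq> ext_dom (\<lambda>_. r')" if "r \<le> r'" for r r'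
    using that unfolding ext_dom_def by fastforce
  have G_Suc: "G (Suc r) s = G r s" if "s \<in> ext_dom (\<lambda>_. r)" for r s
  proof -
    have "rGamma (pairing (\<mu> k) s + (of_nat r - of_int (\<nu> k))) =
      (pairing (\<mu> k) s - of_int (\<nu> k) + of_nat r) * rGamma (pairing (\<mu> k) s + (of_nat (Suc r) - of_int (\<nu> k)))" for k
      using rGamma_plus1[of "pairing (\<mu> k) s - of_int (\<nu> k) + of_nat r"] by (simp add: algebra_simps)
    thus ?thesis unfolding G_def H(3)[OF that] by (simp add: prod.distrib mult_ac)
  qed
  have G_eq: "G r' s = G r s" if "s \<in> ext_dom (\<lambda>_. r)" "r \<le> r'" for r r' s
    using that(2) by (induction rule: dec_induct) (use G_Suc mono that(1) in \<open>auto simp: subset_iff\<close>)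
  have \<Phi>_eq: "\<Phi> s = G r s" if "s \<in> ext_dom (\<lambda>_. r)" for r s
  proof -
    have "s \<in> ext_dom (\<lambda>_. LEAST r. s \<in> ext_dom (\<lambda>_. r))" using that by (rule LeastI)
    moreover have "(LEAST r. s \<in> ext_dom (\<lambda>_. r)) \<le> r" using that by (rule Least_le)
    ultimately show ?thesis unfolding \<Phi>_def by (metis G_eq)
  qed
  have holG: "holomorphic_Cn_on (G r) (ext_dom (\<lambda>_. r))" for r
    unfolding G_def
    by (intro holomorphic_Cn_mult holomorphic_Cn_prod holomorphic_Cn_rGamma_pairing mspan_holomorphic[OF H(2)]) simp
  show ?thesis
  proof (rule that)
    show "holomorphic_Cn_on \<Phi> UNIV"
      unfolding holomorphic_Cn_on_def
    proof
      fix s :: "complex ^ 'n"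
      have "\<exists>r. \<forall>k\<in>{1..N}. of_int (\<nu> k) - Re (pairing (\<mu> k) s) < real r"
      proof -
        have "\<forall>\<^sub>F r in sequentially. \<forall>k\<in>{1..N}. of_int (\<nu> k) - Re (pairing (\<mu> k) s) < real r"
          using filterlim_at_top_dense[THEN iffD1, OF filterlim_real_sequentially]
          by (intro eventually_ball_finite) auto
        thus ?thesis by (auto simp: eventually_sequentially)
      qed
      then obtain r where s: "s \<in> ext_dom (\<lambda>_. r)" by (auto simp: ext_dom_def algebra_simps)
      then obtain L where L: "(G r has_derivative L) (at s)" "\<forall>c v. L (c *s v) = c * L v"
        using holG[of r] unfolding holomorphic_Cn_on_def by blast
      \<comment> \<open>Near \<open>s\<close>, on an open domain, \<Phi> coincides with the single
        function \<open>G r\<close>.\<close>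
      have "(\<Phi> has_derivative L) (at s)"
        by (rule has_derivative_transform_within_open[OF L(1) open_ext_dom s]) (simp add: \<Phi>_eq)
      thus "\<exists>L. (\<Phi> has_derivative L) (at s) \<and> (\<forall>c v. L (c *s v) = c * L v)" using L(2) by blast
    qed
    show "\<Phi> s = I 1 s * (\<Prod>k\<in>{1..N}. rGamma (pairing (\<mu> k) s - of_int (\<nu> k)))" if "s \<in> ext_dom (\<lambda>_. 0)" for s
      using \<Phi>_eq[OF that] by (simp add: G_def H(1))
  qed
qed

section \<open>Identification with the Mellin transform\<close>

lemma ext_dom_0: "ext_dom (\<lambda>_. 0) = region 1"
  by (simp add: ext_dom_def region_def)

lemma
  assumes "s \<in> ext_dom (\<lambda>_. 0)"
  shows mellin_integrable:
      "set_integrable lebesgue pos_orthant (mellin_integrand (\<lambda>z. 1 / laurent a A z) s)"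
    and mellin_eq: "mellin (\<lambda>z. 1 / laurent a A z) s = I 1 s"
proof -
  let ?f = "mellin_integrand (\<lambda>z. 1 / laurent a A z) s"
  let ?g = "\<lambda>z. log_density z *\<^sub>R K 1 s (ln_vec z)"
  \<comment> \<open>The factor 1 / (z_1 ... z_n) of the Mellin integrand becomes the density; the
    rest is \<open>K 1 s\<close> at the logarithm of \<open>z\<close>.\<close>
  have eq: "indicator pos_orthant z *\<^sub>R ?f z = ?g z" for z
  proof (cases "z \<in> pos_orthant")
    case True
    hence pos: "z $ j > 0" for j by (simp add: pos_orthant_def)
    have "complex_of_real (z $ j) powr (s $ j) = exp (s $ j * complex_of_real (ln (z $ j)))" for j
      using pos[of j] by (simp add: powr_def Ln_of_real)
    hence "(\<Prod>j\<in>UNIV. complex_of_real (z $ j) powr (s $ j)) = exp (cpair s (ln_vec z))"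
      by (simp add: cpair_def ln_vec_def exp_sum)
    moreover have "laurent a A (complex_vec z) = E (ln_vec z)"
      by (simp add: E_def exp_ln_vec[OF True])
    ultimately show ?thesis using True
      by (simp add: mellin_integrand_def K_def scaleR_conv_of_real field_simps)
  qed simp
  have int: "integrable lborel (K 1 s)" using assms by (intro K_integrable) (auto simp: ext_dom_0)
  hence intg: "integrable lborel ?g" using integrable_ln_vec_iff[OF K_measurable] by blast
  \<comment> \<open>For a Borel function, integrals over \<open>lborel\<close> and over its
    completion \<open>lebesgue\<close> agree.\<close>
  have meas: "?g \<in> borel_measurable lborel" by measurable
  show "set_integrable lebesgue pos_orthant ?f"
    unfolding set_integrable_def eq using intg meas by (simp only: integrable_completion)
  show "mellin (\<lambda>z. 1 / laurent a A z) s = I 1 s"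
    unfolding mellin_def set_lebesgue_integral_def eq I_def integral_ln_vec[OF K_measurable]
    by (rule integral_completion[OF meas])
qed

end

theorem theorem2:
  fixes A :: "(int ^ 'n) set"
    and a :: "int ^ 'n \<Rightarrow> complex"
    and N :: nat
    and \<mu> :: "nat \<Rightarrow> int ^ 'n"
    and \<nu> :: "nat \<Rightarrow> int"
  assumes "finite A"
    and "\<forall>\<alpha>\<in>A. a \<alpha> \<noteq> 0"
    and "aff_dim (newton_polytope A) = int CARD('n)"
    and "facet_presentation (newton_polytope A) N \<mu> \<nu>"
    and "completely_nonvanishing a A (complex_vec ` pos_orthant)"
  shows "\<exists>F \<Phi>. meromorphic_Cn F \<and>
    (\<forall>s. Re_vec s \<in> interior (newton_polytope A) \<longrightarrow>
       set_integrable lebesgue pos_orthant (mellin_integrand (\<lambda>z. 1 / laurent a A z) s) \<and>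
       F s = mellin (\<lambda>z. 1 / laurent a A z) s) \<and>
    holomorphic_Cn_on \<Phi> UNIV \<and>
    (\<forall>s. (\<forall>k\<in>{1..N}. pairing (\<mu> k) s - of_int (\<nu> k) \<notin> \<int>\<^sub>\<le>\<^sub>0) \<longrightarrow>
       F s = \<Phi> s * (\<Prod>k\<in>{1..N}. Gamma (pairing (\<mu> k) s - of_int (\<nu> k))))"
proof -
  let ?P = "newton_polytope A"
  have P: "?P = (\<Inter>k\<in>{1..N}. {\<sigma>. pairing (\<mu> k) \<sigma> \<ge> of_int (\<nu> k)})"
    and prim: "\<And>k. k \<in> {1..N} \<Longrightarrow> primitive (\<mu> k)"
    using assms(4) unfolding facet_presentation_def by auto
  \<comment> \<open>The empty set has affine dimension -1.\<close>
  have "?P \<noteq> {}" using assms(3) by auto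
  hence "A \<noteq> {}" by (auto simp: newton_polytope_def)
  obtain c where "c > 0" "\<And>x. c * (\<Sum>\<alpha>\<in>A. exp_weight \<alpha> x) \<le> norm (laurent a A (complex_vec (exp_vec x)))"
    using laurent_lower_bound[OF assms(1) \<open>A \<noteq> {}\<close> assms(5)] by metis
  then interpret mellin_data A a N \<mu> \<nu> c
    using assms(1) P \<open>A \<noteq> {}\<close> by unfold_locales auto
  have "convex ?P" by (simp add: newton_polytope_def)
  hence "interior ?P \<noteq> {}"
    using \<open>?P \<noteq> {}\<close> assms(3) interior_rel_interior_gen[of ?P] by (simp add: rel_interior_eq_empty)
  have interior_dom: "s \<in> ext_dom (\<lambda>_. 0)" if "Re_vec s \<in> interior ?P" for s
    unfolding ext_dom_def
  proof (intro CollectI ballI)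
    fix k assume k: "k \<in> {1..N}"
    \<comment> \<open>The gcd of zeros is 0, so a primitive vector is nonzero and the interior of
      its half-space is given by the strict inequality.\<close>
    have "\<mu> k \<noteq> 0"
    proof
      assume "\<mu> k = 0"
      hence "range (\<lambda>j. \<mu> k $ j) = {0}" by auto
      thus False using prim[OF k] by (simp add: primitive_def)
    qed
    hence "real_vec (\<mu> k) \<noteq> 0" by (auto simp: real_vec_def vec_eq_iff)
    moreover have "interior ?P \<subseteq> interior {\<sigma>. real_vec (\<mu> k) \<bullet> \<sigma> \<ge> of_int (\<nu> k)}"
      using k unfolding P by (intro interior_mono) (auto simp: pairing_real)
    ultimately have "Re_vec s \<in> {\<sigma>. real_vec (\<mu> k) \<bullet> \<sigma> > of_int (\<nu> k)}"
      using that by (auto simp: interior_halfspace_ge)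
    thus "of_int (\<nu> k) - real 0 < Re (pairing (\<mu> k) s)" by (simp add: Re_pairing)
  qed
  obtain \<Phi> where \<Phi>: "holomorphic_Cn_on \<Phi> UNIV"
    "\<And>s. s \<in> ext_dom (\<lambda>_. 0) \<Longrightarrow> \<Phi> s = I 1 s * (\<Prod>k\<in>{1..N}. rGamma (pairing (\<mu> k) s - of_int (\<nu> k)))"
    using entire_factor by metis
  define h where "h s = (\<Prod>k\<in>{1..N}. rGamma (pairing (\<mu> k) s - of_int (\<nu> k)))" for s :: "complex ^ 'n"
  define F where "F s = \<Phi> s * (\<Prod>k\<in>{1..N}. Gamma (pairing (\<mu> k) s - of_int (\<nu> k)))" for s
  \<comment> \<open>Valid at the poles too: there \<open>Gamma\<close> and division by zero both
    return 0.\<close>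
  have F_eq: "F s = \<Phi> s / h s" for s
    by (simp add: F_def h_def Gamma_def prod_inversef divide_inverse flip: prod_inversef)
  have h_nz: "h s \<noteq> 0" if "s \<in> ext_dom (\<lambda>_. 0)" for s
  proof -
    have "pairing (\<mu> k) s - of_int (\<nu> k) \<notin> \<int>\<^sub>\<le>\<^sub>0" if "k \<in> {1..N}" for k
    proof
      assume "pairing (\<mu> k) s - of_int (\<nu> k) \<in> \<int>\<^sub>\<le>\<^sub>0"
      then obtain n where "pairing (\<mu> k) s - of_int (\<nu> k) = of_int n" "n \<le> 0" by (rule nonpos_Ints_cases)
      hence "Re (pairing (\<mu> k) s - of_int (\<nu> k)) \<le> 0" by simp
      thus False using \<open>s \<in> ext_dom _\<close> that by (force simp: ext_dom_def)
    qed
    thus ?thesis by (simp add: h_def rGamma_eq_zero_iff)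
  qed
  have "meromorphic_Cn F"
    unfolding meromorphic_Cn_def
  proof (rule allI, rule exI[of _ UNIV], rule exI[of _ \<Phi>], rule exI[of _ h], intro conjI)
    show "holomorphic_Cn_on h UNIV"
      unfolding h_def diff_conv_add_uminus by (intro holomorphic_Cn_prod holomorphic_Cn_rGamma_pairing)
    \<comment> \<open>Full dimension provides an interior point; read as a complex vector, it shows
      that \<open>h\<close> is not identically zero.\<close>
    obtain \<sigma> where "\<sigma> \<in> interior ?P" using \<open>interior ?P \<noteq> {}\<close> by blast
    moreover have "Re_vec (complex_vec \<sigma>) = \<sigma>" by (simp add: Re_vec_def complex_vec_def vec_eq_iff)
    ultimately show "\<exists>s\<in>UNIV. h s \<noteq> 0" using h_nz[OF interior_dom] by (metis UNIV_I)
    show "\<forall>s\<in>UNIV. h s \<noteq> 0 \<longrightarrow> F s = \<Phi> s / h s" by (simp add: F_eq)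
  qed (use \<Phi>(1) in auto)
  moreover have "set_integrable lebesgue pos_orthant (mellin_integrand (\<lambda>z. 1 / laurent a A z) s) \<and>
       F s = mellin (\<lambda>z. 1 / laurent a A z) s" if "Re_vec s \<in> interior ?P" for s
  proof -
    note s = interior_dom[OF that]
    have "F s = I 1 s" using \<Phi>(2)[OF s] h_nz[OF s] by (simp add: F_eq h_def)
    thus ?thesis using mellin_integrable[OF s] mellin_eq[OF s] by simp
  qed
  ultimately show ?thesis using \<Phi>(1) F_def by blast
qed

end
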